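(* Assume $n=1$, $\delta_1\in[0,1/2)$ and $\delta_1'\in[1/2,1)$. Then there is $\kappa\in(0,1]$ and, for each $R>0$, there is $\lambda_R>0$ such that \[ \int_{B(x;r)}\Gamma(\varphi)(y)\,dy\ \ge\ \lambda_R\,r^{-2}\int_{B(x;\kappa r)}\big(\varphi(y)-\langle\varphi\rangle_B\big)^2dy \] for all $x\in\mathbb R^{1+m}$, all $r\in(0,R]$ and all $\varphi\in C^1(\mathbb R^{1+m})$, where $\langle\varphi\rangle_B=|B(x;\kappa r)|^{-1}\int_{B(x;\kappa r)}\varphi$.
   Context: Let $m\ge1$, $x=(x_1,x_2)\in\mathbb R\times\mathbb R^m$, $|\cdot|$ Euclidean norms. For $a\ge0$, $a^{(\alpha,\alpha')}=a^\alpha$ if $a\le1$ and $a^{\alpha'}$ if $a\ge1$. Fix $\delta_1,\delta_1'\in[0,1)$, $\delta_2,\delta_2'\ge0$. Let $C_\delta(x)=|x_1|^{(2\delta_1,2\delta_1')}\oplus|x_1|^{(2\delta_2,2\delta_2')}I_m$ and let $C=(c_{ij})$ be a real symmetric measurable matrix function with $a\,C_\delta\le C\le a'\,C_\delta$ a.e. for some $a,a'>0$. $\Gamma(\varphi)=\sum c_{ij}\partial_i\varphi\,\partial_j\varphi$. The distance is $d(x;y)=\sup\{\psi(x)-\psi(y):\psi\in C^1(\mathbb R^{1+m}),\ \Gamma(\psi)\le1\}$, $B(x;r)=\{y:d(x;y)<r\}$, $|B|$ Lebesgue measure. *)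

theory Defs
  imports "HOL-Analysis.Analysis"
begin

text \<open>Points of R^(1+m) are vectors indexed by 'm option: coordinate None is x_1,
  coordinates Some i (i :: 'm) form x_2 in R^m (m = CARD('m) \<ge> 1).\<close>

type_synonym 'm pt = "real ^ ('m option)"
type_synonym 'm mat = "real ^ ('m option) ^ ('m option)"

definition x1 :: "'m::finite pt \<Rightarrow> real" where
  "x1 x = x $ None"

definition x2 :: "'m::finite pt \<Rightarrow> real ^ 'm" where
  "x2 x = (\<chi> i. x $ Some i)"

definition pw :: "real \<Rightarrow> real \<Rightarrow> real \<Rightarrow> real" where
  "pw a \<alpha> \<alpha>' = (if a = 0 then (if \<alpha> = 0 then 1 else 0)
                   else if a \<le> 1 then a powr \<alpha> else a powr \<alpha>')"

definition Cdelta :: "real \<Rightarrow> real \<Rightarrow> real \<Rightarrow> real \<Rightarrow> 'm::finite pt \<Rightarrow> 'm mat" where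
  "Cdelta d1 d1' d2 d2' x = (\<chi> i j. if i = j then
       (if i = None then pw \<bar>x1 x\<bar> (2*d1) (2*d1') else pw \<bar>x1 x\<bar> (2*d2) (2*d2')) else 0)"

definition mat_le :: "'m::finite mat \<Rightarrow> 'm mat \<Rightarrow> bool" where
  "mat_le A B \<longleftrightarrow> (\<forall>\<xi>. \<xi> \<bullet> (A *v \<xi>) \<le> \<xi> \<bullet> (B *v \<xi>))"

definition grad :: "('m::finite pt \<Rightarrow> real) \<Rightarrow> 'm pt \<Rightarrow> 'm pt" where
  "grad \<phi> x = (\<chi> i. frechet_derivative \<phi> (at x) (axis i 1))"

definition C1 :: "('m::finite pt \<Rightarrow> real) set" where
  "C1 = {\<phi>. (\<forall>x. \<phi> differentiable (at x)) \<and> (\<forall>i. continuous_on UNIV (\<lambda>x. grad \<phi> x $ i))}"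

definition Gamma :: "('m::finite pt \<Rightarrow> 'm mat) \<Rightarrow> ('m pt \<Rightarrow> real) \<Rightarrow> 'm pt \<Rightarrow> real" where
  "Gamma C \<phi> x = grad \<phi> x \<bullet> (C x *v grad \<phi> x)"

text \<open>Intrinsic distance; the constraint Gamma(psi) \<le> 1 is understood almost everywhere
  (C is only defined up to null sets).  Values in the extended reals.\<close>
definition dist_C :: "('m::finite pt \<Rightarrow> 'm mat) \<Rightarrow> 'm pt \<Rightarrow> 'm pt \<Rightarrow> ereal" where
  "dist_C C x y = (SUP \<psi> \<in> {\<psi> \<in> C1. AE z in lebesgue. Gamma C \<psi> z \<le> 1}. ereal (\<psi> x - \<psi> y))"

definition ballC :: "('m::finite pt \<Rightarrow> 'm mat) \<Rightarrow> 'm pt \<Rightarrow> real \<Rightarrow> 'm pt set" where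
  "ballC C x r = {y. dist_C C x y < ereal r}"

definition avg :: "('m::finite pt \<Rightarrow> real) \<Rightarrow> 'm pt set \<Rightarrow> real" where
  "avg \<phi> B = (\<integral>y\<in>B. \<phi> y \<partial>lebesgue) / measure lebesgue B"

end

theory Submission
  imports Defs
begin

text \<open>
  The coordinate F with F' = |x_1|^(-(delta_1, delta_1')) makes the first direction Euclidean. The intrinsic
  ball of radius r is comparable, uniformly in r and in its centre x, to the slab of all y with
  |F(y_1) - F(x_1)| \<le> r and |y_2 - x_2| \<le> r G, where G is the largest value of the second
  weight over the first projection of the slab: one reaches y by moving in the first direction to the
  point where G is attained, then sideways, then back; conversely, a product of bump functions
  separates x from the complement of the slab.

  On a slab I \<times> J, fix a good slice z, chosen in a part of I where the second weight is of order G, and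
  compare phi with a constant on that slice by the Euclidean Poincare inequality on J. The passage from t to z along
  the first direction costs |I| times the integral of |t|^(-2(delta_1, delta_1')) over I, which is
  O(r^2) for bounded r because delta_1 < 1/2.
\<close>

section \<open>The weights on the first coordinate\<close>

lemma pw_pos: "0 < s \<Longrightarrow> 0 < pw s d d'"
  by (simp add: pw_def)

lemma pw_nonneg: "0 \<le> pw s d d'"
  by (simp add: pw_def)

lemma pw_double: "pw s (2*d) (2*d') = (pw s d d')\<^sup>2"
  by (auto simp: pw_def powr_add[symmetric] power2_eq_square)

lemma pw_mono:
  assumes "0 \<le> s" "s \<le> t" "0 \<le> d" "0 \<le> d'"
  shows "pw s d d' \<le> pw t d d'"
proof -
  have "s powr d \<le> 1" if "s \<le> 1"
    using that assms powr_mono2[of d s 1] by simp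
  moreover have "1 \<le> t powr d'" if "1 \<le> t"
    using that assms ge_one_powr_ge_zero by blast
  ultimately show ?thesis
    using assms by (auto simp: pw_def powr_mono2 intro: order_trans)
qed

lemma pw_doubling:
  assumes "0 < t" "t / 2 \<le> s" "s \<le> t" "0 \<le> d" "0 \<le> d'"
  shows "pw t d d' \<le> 2 powr (d + d') * pw s d d'"
proof -
  have s: "0 < s" using assms by simp
  have A: "t powr e \<le> 2 powr e * s powr e" if "0 \<le> e" for e
    using that assms s powr_mono2[of e t "2 * s"] by (simp add: powr_mult)
  have B: "2 powr d \<le> 2 powr (d + d')" "2 powr d' \<le> 2 powr (d + d')"
    using assms by auto
  have A1: "t powr d \<le> 2 powr (d + d') * s powr d"
    using order_trans[OF A[OF assms(4)] mult_right_mono[OF B(1)]] by simp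
  have A2: "t powr d' \<le> 2 powr (d + d') * s powr d'"
    using order_trans[OF A[OF assms(5)] mult_right_mono[OF B(2)]] by simp
  have A3: "t powr d' \<le> 2 powr (d + d') * s powr d" if "s \<le> 1" "1 < t"
  proof -
    have "t powr d' \<le> 2 powr d'" using that assms by (intro powr_mono2) auto
    moreover have "1 \<le> 2 powr d * s powr d"
      using that assms powr_mono2[of d 1 "2 * s"] by (simp add: powr_mult)
    hence "2 powr d' \<le> 2 powr (d + d') * s powr d"
      using mult_left_mono[of 1 "2 powr d * s powr d" "2 powr d'"] by (simp add: powr_add mult_ac)
    ultimately show ?thesis by simp
  qed
  show ?thesis using s assms A1 A2 A3 by (auto simp: pw_def)
qed

lemma pw_power_comparison:
  assumes "0 < s" "s \<le> M" "M \<le> B" "1 \<le> B" "d \<le> d'" "d' \<le> d + 1"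
  shows "pw M d d' * s powr d \<le> B * (pw s d d' * M powr d)"
proof -
  have M: "0 < M" using assms by simp
  have A: "pw M d d' \<le> B * M powr d"
  proof (cases "M \<le> 1")
    case True
    then show ?thesis using M assms mult_right_mono[of 1 B "M powr d"] by (simp add: pw_def)
  next
    case False
    have "M powr d' = M powr (d' - d) * M powr d" by (simp add: powr_add[symmetric])
    also have "M powr (d' - d) \<le> M powr 1" using False assms by (intro powr_mono) auto
    also have "M powr 1 \<le> B" using M assms by simp
    finally show ?thesis using False M assms by (simp add: pw_def mult_right_mono)
  qed
  have B: "s powr d \<le> pw s d d'"
    using assms by (auto simp: pw_def)
  have "pw M d d' * s powr d \<le> (B * M powr d) * pw s d d'"
    using A B by (intro mult_mono) (use assms in auto)
  then show ?thesis by (simp add: mult_ac)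
qed

lemma continuous_on_pw:
  assumes "0 \<le> d" "0 \<le> d'"
  shows "continuous_on {0..} (\<lambda>s. pw s d d')"
proof -
  have 1: "continuous_on {0..1} (\<lambda>s. pw s d d')"
  proof (cases "d = 0")
    case True
    have "continuous_on {0..1::real} (\<lambda>s. 1::real)" by simp
    then show ?thesis by (rule continuous_on_eq) (auto simp: pw_def True)
  next
    case False
    have "continuous_on {0..1::real} (\<lambda>s. s powr d)"
      using assms False by (intro continuous_on_powr') (auto intro: continuous_intros)
    then show ?thesis by (rule continuous_on_eq) (auto simp: pw_def False)
  qed
  have 2: "continuous_on {1..} (\<lambda>s. pw s d d')"
  proof -
    have "continuous_on {1..} (\<lambda>s::real. s powr d')"
      by (intro continuous_intros) auto
    then show ?thesis by (rule continuous_on_eq) (auto simp: pw_def)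
  qed
  have "{0..} = {0..1} \<union> {1::real..}" by auto
  then show ?thesis using continuous_on_closed_Un[OF _ _ 1 2] by simp
qed

lemma continuous_on_pw_abs:
  assumes "0 \<le> d" "0 \<le> d'" "continuous_on S f"
  shows "continuous_on S (\<lambda>x. pw \<bar>f x\<bar> d d')"
  by (rule continuous_on_compose2[OF continuous_on_pw[OF assms(1,2)]])
     (use assms(3) in \<open>auto intro!: continuous_intros\<close>)

lemma increasing_except_zero:
  fixes f :: "real \<Rightarrow> real"
  assumes "continuous_on UNIV f" "\<And>t. t \<noteq> 0 \<Longrightarrow> \<exists>y\<ge>0. (f has_real_derivative y) (at t)" "s \<le> t"
  shows "f s \<le> f t"
proof -
  have *: "f p \<le> f q" if "p \<le> q" "0 \<le> p \<or> q \<le> 0" for p q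
  proof (rule DERIV_nonneg_imp_increasing_open[OF that(1)])
    fix x assume "p < x" "x < q"
    with that(2) assms(2)[of x] show "\<exists>y. (f has_real_derivative y) (at x) \<and> 0 \<le> y" by fastforce
  qed (use assms(1) continuous_on_subset in blast)
  show ?thesis
    using *[of s t] *[of s 0] *[of 0 t] assms(3) by fastforce
qed

lemma ex_antiderivative:
  fixes f :: "real \<Rightarrow> real"
  assumes "continuous_on UNIV f"
  shows "\<exists>F. \<forall>t. (F has_real_derivative f t) (at t)"
proof -
  have "isCont f x" for x
    using assms by (simp add: continuous_on_eq_continuous_at)
  then show ?thesis
    using einterval_antiderivative[of "-\<infinity>" "\<infinity>" f]
    by (auto simp: has_real_derivative_iff_has_vector_derivative)
qed

lemma powr_antiderivative:
  fixes d :: real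
  assumes "d < 1"
  defines "A \<equiv> \<lambda>t. sgn t * \<bar>t\<bar> powr (1 - d) / (1 - d)"
  shows "continuous_on UNIV A"
    and "t \<noteq> 0 \<Longrightarrow> (A has_real_derivative \<bar>t\<bar> powr (-d)) (at t)"
proof -
  have 1: "continuous_on {0..} A"
  proof -
    have "continuous_on {0..} (\<lambda>t::real. t powr (1 - d) / (1 - d))"
      using assms(1) by (intro continuous_on_divide continuous_on_powr') (auto intro: continuous_intros)
    then show ?thesis by (rule continuous_on_eq) (auto simp: A_def sgn_if)
  qed
  have 2: "continuous_on {..0} A"
  proof -
    have "continuous_on {..0} (\<lambda>t::real. - ((-t) powr (1 - d)) / (1 - d))"
      using assms(1) by (intro continuous_on_divide continuous_on_minus continuous_on_powr') (auto intro: continuous_intros)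
    then show ?thesis by (rule continuous_on_eq) (auto simp: A_def sgn_if)
  qed
  have "UNIV = {0..} \<union> {..0::real}" by auto
  then show "continuous_on UNIV A"
    using continuous_on_closed_Un[OF _ _ 1 2] by simp
  show "(A has_real_derivative \<bar>t\<bar> powr (-d)) (at t)" if "t \<noteq> 0"
  proof (cases "0 < t")
    case True
    have "((\<lambda>t. t powr (1 - d) / (1 - d)) has_real_derivative \<bar>t\<bar> powr (-d)) (at t)"
      using True assms(1) by (auto intro!: derivative_eq_intros)
    then show ?thesis
      by (rule has_field_derivative_transform_within_open[of _ _ _ "{0<..}"])
         (use True in \<open>auto simp: A_def\<close>)
  next
    case False
    have "((\<lambda>t. - ((-t) powr (1 - d)) / (1 - d)) has_real_derivative \<bar>t\<bar> powr (-d)) (at t)"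
      using False that assms(1) by (auto intro!: derivative_eq_intros)
    then show ?thesis
      by (rule has_field_derivative_transform_within_open[of _ _ _ "{..<0}"])
         (use False that in \<open>auto simp: A_def\<close>)
  qed
qed

lemma ex_weighted_coordinate:
  assumes "d < 1"
  shows "\<exists>F. continuous_on UNIV F \<and>
     (\<forall>t. t \<noteq> 0 \<longrightarrow> (F has_real_derivative 1 / pw \<bar>t\<bar> d d') (at t))"
proof -
  define c where "c t = max 1 \<bar>t\<bar> powr (-d') - max 1 \<bar>t\<bar> powr (-d)" for t :: real
  have "continuous_on UNIV c"
    unfolding c_def by (intro continuous_intros) auto
  then obtain B where B: "\<And>t. (B has_real_derivative c t) (at t)"
    using ex_antiderivative by blast
  define A where "A t = sgn t * \<bar>t\<bar> powr (1 - d) / (1 - d)" for t :: real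
  note A = powr_antiderivative[OF assms, folded A_def]
  have "continuous_on UNIV (\<lambda>t. A t + B t)"
    using A(1) B by (intro continuous_on_add) (auto intro: DERIV_continuous_on)
  moreover have "((\<lambda>t. A t + B t) has_real_derivative 1 / pw \<bar>t\<bar> d d') (at t)" if "t \<noteq> 0" for t
  proof -
    have "\<bar>t\<bar> powr (-d) + c t = 1 / pw \<bar>t\<bar> d d'"
      using that by (auto simp: c_def pw_def powr_minus_divide max_def)
    then show ?thesis using DERIV_add[OF A(2)[OF that] B[of t]] by simp
  qed
  ultimately show ?thesis by blast
qed

locale weight =
  fixes d d' :: real and F :: "real \<Rightarrow> real"
  assumes d: "0 \<le> d" "d < 1" "0 \<le> d'" "d' < 1"
    and F_cont: "continuous_on UNIV F"
    and F_deriv: "\<And>t. t \<noteq> 0 \<Longrightarrow> (F has_real_derivative 1 / pw \<bar>t\<bar> d d') (at t)"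
begin

lemma F_mono: "s \<le> t \<Longrightarrow> F s \<le> F t"
  by (rule increasing_except_zero[OF F_cont])
     (auto intro!: exI[of _ "1 / pw \<bar>_\<bar> d d'"] F_deriv simp: pw_nonneg)

lemma F_increment_ge:
  assumes "s \<le> t" "\<bar>s\<bar> \<le> M" "\<bar>t\<bar> \<le> M" "0 < M"
  shows "(t - s) / pw M d d' \<le> F t - F s"
proof -
  have F_lin: "F p - p / pw M d d' \<le> F q - q / pw M d d'"
    if "p \<le> q" "0 \<le> p \<or> q \<le> 0" "\<bar>p\<bar> \<le> M" "\<bar>q\<bar> \<le> M" for p q
  proof (rule DERIV_nonneg_imp_increasing_open[OF that(1)])
    fix x assume x: "p < x" "x < q"
    then have "x \<noteq> 0" "\<bar>x\<bar> \<le> M" using that by auto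
    then have "1 / pw M d d' \<le> 1 / pw \<bar>x\<bar> d d'"
      using pw_mono[of "\<bar>x\<bar>" M d d'] pw_pos[of "\<bar>x\<bar>" d d'] d by (intro divide_left_mono) (auto simp: assms(4) pw_pos)
    moreover have "((\<lambda>x. F x - x / pw M d d') has_real_derivative 1 / pw \<bar>x\<bar> d d' - 1 / pw M d d') (at x)"
      using F_deriv[OF \<open>x \<noteq> 0\<close>] pw_pos[OF assms(4), of d d'] by (auto intro!: derivative_eq_intros)
    ultimately show "\<exists>y. ((\<lambda>x. F x - x / pw M d d') has_real_derivative y) (at x) \<and> 0 \<le> y"
      by force
  next
    show "continuous_on {p..q} (\<lambda>x. F x - x / pw M d d')"
      using continuous_on_subset[OF F_cont] pw_pos[OF assms(4), of d d'] by (intro continuous_intros) auto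
  qed
  have "F s - s / pw M d d' \<le> F t - t / pw M d d'"
    using F_lin[of s t] F_lin[of s 0] F_lin[of 0 t] assms by fastforce
  then show ?thesis by (simp add: diff_divide_distrib)
qed

lemma F_unbounded:
  shows "\<exists>t. c \<le> F t" "\<exists>t. F t \<le> c"
proof -
  define N where "N = max 1 ((\<bar>c - F 0\<bar>) powr (1 / (1 - d')))"
  have N: "1 \<le> N" by (simp add: N_def)
  have "\<bar>c - F 0\<bar> = (\<bar>c - F 0\<bar> powr (1 / (1 - d'))) powr (1 - d')"
    using d by (cases "c = F 0") (auto simp: powr_powr)
  also have "\<dots> \<le> N powr (1 - d')"
    using d by (intro powr_mono2) (auto simp: N_def)
  also have "\<dots> = N / pw N d d'"
    using N by (auto simp: pw_def powr_diff)
  finally have *: "\<bar>c - F 0\<bar> \<le> N / pw N d d'" .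
  have "c \<le> F N" using F_increment_ge[of 0 N N] N * by simp
  moreover have "F (- N) \<le> c" using F_increment_ge[of "- N" 0 N] N * by simp
  ultimately show "\<exists>t. c \<le> F t" "\<exists>t. F t \<le> c" by blast+
qed

lemma F_surj: "\<exists>t. F t = c"
proof -
  obtain p q where "F p \<le> c" "c \<le> F q" using F_unbounded by metis
  moreover have "F (min p q) \<le> F p" "F q \<le> F (max p q)" by (auto intro: F_mono)
  ultimately show ?thesis
    using IVT'[of F "min p q" c "max p q"] continuous_on_subset[OF F_cont] by fastforce
qed

lemma F_strict_mono: assumes "s < t" shows "F s < F t"
proof -
  define M where "M = max \<bar>s\<bar> \<bar>t\<bar>"
  have "0 < M" using assms by (auto simp: M_def)
  then have "0 < (t - s) / pw M d d'" using assms pw_pos by simp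
  then show ?thesis
    using F_increment_ge[of s t M] assms \<open>0 < M\<close> by (simp add: M_def)
qed

lemma F_less_iff: "F s < F t \<longleftrightarrow> s < t"
  using F_strict_mono F_mono by (meson linorder_not_less)

text \<open>F itself is not differentiable at 0 when d > 0, so it cannot enter a test function of class C1.\<close>

lemma ex_smooth_coordinate:
  assumes "0 < e"
  shows "\<exists>H h. (\<forall>t. (H has_real_derivative h t) (at t)) \<and> continuous_on UNIV h
    \<and> (\<forall>t. 0 \<le> h t \<and> pw \<bar>t\<bar> d d' * h t \<le> 1)
    \<and> (\<forall>s t. \<bar>(F t - F s) - (H t - H s)\<bar> \<le> e)"
proof -
  obtain \<delta> where \<delta>: "0 < \<delta>" "\<And>t. \<bar>t\<bar> \<le> \<delta> \<Longrightarrow> \<bar>F t - F 0\<bar> < e / 2"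
  proof -
    have "isCont F 0" using F_cont by (simp add: continuous_on_eq_continuous_at)
    then obtain s where "0 < s" "\<And>t. \<bar>t\<bar> < s \<Longrightarrow> \<bar>F t - F 0\<bar> < e / 2"
      using half_gt_zero[OF assms] unfolding continuous_at_eps_delta dist_real_def diff_0_right by blast
    then show ?thesis using that[of "s / 2"] by auto
  qed
  define h where "h t = 1 / pw (max \<bar>t\<bar> \<delta>) d d'" for t
  have pos: "0 < pw (max \<bar>t\<bar> \<delta>) d d'" for t using \<delta> by (intro pw_pos) auto
  have h_cont: "continuous_on UNIV h"
  proof -
    have "continuous_on UNIV (\<lambda>t. pw \<bar>max \<bar>t\<bar> \<delta>\<bar> d d')"
      by (intro continuous_on_pw_abs continuous_intros) (use d in auto)
    moreover have "\<bar>max \<bar>t\<bar> \<delta>\<bar> = max \<bar>t\<bar> \<delta>" for t using \<delta>(1) by simp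
    ultimately have "continuous_on UNIV (\<lambda>t. pw (max \<bar>t\<bar> \<delta>) d d')" by simp
    then show ?thesis unfolding h_def by (intro continuous_intros) (simp_all add: less_imp_neq[OF pos, symmetric])
  qed
  then obtain H where H: "\<And>t. (H has_real_derivative h t) (at t)"
    using ex_antiderivative by blast
  have h_le: "h t \<le> 1 / pw \<bar>t\<bar> d d'" if "t \<noteq> 0" for t
    unfolding h_def using pw_mono[of "\<bar>t\<bar>" "max \<bar>t\<bar> \<delta>" d d'] d that pw_pos[of "\<bar>t\<bar>" d d'] pos[of t]
    by (intro divide_left_mono) auto
  define D where "D t = F t - H t" for t
  have D_cont: "continuous_on UNIV D"
    unfolding D_def using F_cont H by (intro continuous_on_diff) (auto intro: DERIV_continuous_on)
  have D_deriv: "(D has_real_derivative (1 / pw \<bar>t\<bar> d d' - h t)) (at t)" if "t \<noteq> 0" for t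
    unfolding D_def using F_deriv[OF that] H by (rule DERIV_diff)
  have D_mono: "D s \<le> D t" if "s \<le> t" for s t
    using that by (rule increasing_except_zero[OF D_cont _ , rotated]) (auto intro!: exI[of _ "1 / pw \<bar>_\<bar> d d' - h _"] D_deriv h_le)
  have H_mono: "H s \<le> H t" if "s \<le> t" for s t
    using that by (rule DERIV_nonneg_imp_nondecreasing) (auto intro!: exI[of _ "h _"] H simp: h_def pw_nonneg)
  have D_right: "D t = D \<delta>" if "\<delta> \<le> t" for t
  proof (cases "t = \<delta>")
    case False
    show ?thesis
    proof (rule DERIV_isconst_end[where f = D])
      fix x assume "\<delta> < x" "x < t"
      then show "(D has_real_derivative 0) (at x)" using D_deriv[of x] \<delta> by (simp add: h_def max_def)
    qed (use that False continuous_on_subset[OF D_cont] in auto)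
  qed simp
  have D_left: "D (- \<delta>) = D t" if "t \<le> - \<delta>" for t
  proof (cases "t = - \<delta>")
    case False
    show ?thesis
    proof (rule DERIV_isconst_end[where f = D])
      fix x assume "t < x" "x < - \<delta>"
      then show "(D has_real_derivative 0) (at x)" using D_deriv[of x] \<delta> by (simp add: h_def max_def)
    qed (use that False continuous_on_subset[OF D_cont] in auto)
  qed simp
  have D_bounds: "D (- \<delta>) \<le> D t" "D t \<le> D \<delta>" for t
    using D_mono[of "- \<delta>" t] D_left[of t] D_mono[of t \<delta>] D_right[of t] by linarith+
  have "D \<delta> - D (- \<delta>) \<le> F \<delta> - F (- \<delta>)"
    unfolding D_def using H_mono[of "- \<delta>" \<delta>] \<delta> by simp
  also have "\<dots> \<le> e" using \<delta>(2)[of \<delta>] \<delta>(2)[of "- \<delta>"] \<delta>(1) by (simp add: abs_if split: if_splits)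
  finally have D_e: "D \<delta> - D (- \<delta>) \<le> e" .
  have "\<bar>(F t - F s) - (H t - H s)\<bar> \<le> e" for s t
    using D_e D_bounds[of s] D_bounds[of t] by (simp add: D_def abs_le_iff)
  moreover have "0 \<le> h t" "pw \<bar>t\<bar> d d' * h t \<le> 1" for t
    using pos[of t] pw_mono[of "\<bar>t\<bar>" "max \<bar>t\<bar> \<delta>" d d'] d by (auto simp: h_def)
  ultimately show ?thesis using H h_cont by blast
qed

end

lemma nn_integral_powr_le:
  assumes "p < 1" "0 \<le> M"
  shows "(\<integral>\<^sup>+ t\<in>{-M..M}. ennreal (\<bar>t\<bar> powr (-p)) \<partial>lborel) \<le> ennreal (2 * M powr (1 - p) / (1 - p))"
proof -
  let ?f = "\<lambda>t::real. ennreal (\<bar>t\<bar> powr (-p)) * indicator {0..M} t"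
  have "(\<integral>\<^sup>+ t. ?f t \<partial>lborel) = (\<integral>\<^sup>+ t. ennreal (t powr (-p)) * indicator {0..M} t \<partial>lborel)"
    by (intro nn_integral_cong) (auto simp: indicator_def)
  also have "\<dots> = ennreal (M powr (-p + 1) / (-p + 1))"
    by (intro nn_integral_has_integral_lebesgue' has_integral_powr_from_0) (use assms in auto)
  finally have I: "(\<integral>\<^sup>+ t. ?f t \<partial>lborel) = ennreal (M powr (1 - p) / (1 - p))" by (simp add: add.commute)
  have "(\<integral>\<^sup>+ t\<in>{-M..M}. ennreal (\<bar>t\<bar> powr (-p)) \<partial>lborel) \<le> (\<integral>\<^sup>+ t. ?f t + ?f (- t) \<partial>lborel)"
    by (intro nn_integral_mono) (auto simp: indicator_def)
  also have "\<dots> = (\<integral>\<^sup>+ t. ?f t \<partial>lborel) + (\<integral>\<^sup>+ t. ?f (- t) \<partial>lborel)"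
    by (intro nn_integral_add) measurable
  also have "(\<integral>\<^sup>+ t. ?f (- t) \<partial>lborel) = (\<integral>\<^sup>+ t. ?f t \<partial>lborel)"
    using nn_integral_real_affine[of ?f "-1" 0] by simp
  finally show ?thesis
    using assms by (simp add: I flip: ennreal_plus)
qed

lemma borel_measurable_pw [measurable]: "(\<lambda>s. pw s d d') \<in> borel_measurable borel"
  unfolding pw_def by measurable

lemma nn_integral_le_const:
  assumes "\<And>t. t \<in> {\<alpha>..\<beta>} \<Longrightarrow> f t \<le> c" "\<alpha> \<le> (\<beta>::real)" "0 \<le> c"
  shows "(\<integral>\<^sup>+ t\<in>{\<alpha>..\<beta>}. ennreal (f t) \<partial>lborel) \<le> ennreal (c * (\<beta> - \<alpha>))"
proof -
  have "(\<integral>\<^sup>+ t\<in>{\<alpha>..\<beta>}. ennreal (f t) \<partial>lborel) \<le> (\<integral>\<^sup>+ t. ennreal c * indicator {\<alpha>..\<beta>} t \<partial>lborel)"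
    using assms(1) by (intro nn_integral_mono) (auto simp: indicator_def ennreal_leI)
  then show ?thesis
    using assms(2,3) by (simp add: nn_integral_cmult_indicator ennreal_mult)
qed

text \<open>If the interval stays away from 0 relative to its largest absolute value M, the weight is
  almost constant on it; otherwise its length is comparable to M and the bound on
  F \<beta> - F \<alpha> limits M, so that the weight is comparable to its power law at 0.\<close>

lemma (in weight) reverse_Hoelder:
  assumes "d < 1/2" "d \<le> d'" "0 < L"
  shows "\<exists>K>0. \<forall>\<alpha> \<beta>. \<alpha> < \<beta> \<longrightarrow> F \<beta> - F \<alpha> \<le> L \<longrightarrow>
    ennreal (\<beta> - \<alpha>) * (\<integral>\<^sup>+ t\<in>{\<alpha>..\<beta>}. ennreal ((1 / pw \<bar>t\<bar> d d')\<^sup>2) \<partial>lborel)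
      \<le> ennreal (K * (F \<beta> - F \<alpha>)\<^sup>2)"
proof -
  define B where "B = max 1 ((2 * L) powr (1 / (1 - d')))"
  define K1 where "K1 = (2 powr (d + d'))\<^sup>2"
  define K2 where "K2 = 4 * B\<^sup>2 / (1 - 2 * d)"
  have B: "1 \<le> B" by (simp add: B_def)
  have K: "0 < K1" "0 < K2" using B assms by (auto simp: K1_def K2_def)
  show ?thesis
  proof (intro exI[of _ "K1 + K2"] conjI allI impI)
    show "0 < K1 + K2" using K by simp
    fix \<alpha> \<beta> :: real
    assume ab: "\<alpha> < \<beta>" and L: "F \<beta> - F \<alpha> \<le> L"
    define M where "M = max \<bar>\<alpha>\<bar> \<bar>\<beta>\<bar>"
    define P where "P = pw M d d'"
    have M: "0 < M" "\<bar>\<alpha>\<bar> \<le> M" "\<bar>\<beta>\<bar> \<le> M" using ab by (auto simp: M_def)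
    have P: "0 < P" unfolding P_def by (rule pw_pos[OF M(1)])
    have len: "(\<beta> - \<alpha>) / P \<le> F \<beta> - F \<alpha>"
      unfolding P_def using ab M by (intro F_increment_ge) auto
    have len0: "0 \<le> (\<beta> - \<alpha>) / P" using ab P by simp
    have "\<exists>Z. (\<integral>\<^sup>+ t\<in>{\<alpha>..\<beta>}. ennreal ((1 / pw \<bar>t\<bar> d d')\<^sup>2) \<partial>lborel) \<le> ennreal Z
      \<and> (\<beta> - \<alpha>) * Z \<le> (K1 + K2) * (F \<beta> - F \<alpha>)\<^sup>2"
    proof (cases "\<forall>t\<in>{\<alpha>..\<beta>}. M / 2 \<le> \<bar>t\<bar>")
      case True
      have "(1 / pw \<bar>t\<bar> d d')\<^sup>2 \<le> K1 / P\<^sup>2" if "t \<in> {\<alpha>..\<beta>}" for t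
      proof -
        have t: "M / 2 \<le> \<bar>t\<bar>" "\<bar>t\<bar> \<le> M" using True that M by auto
        have "P \<le> 2 powr (d + d') * pw \<bar>t\<bar> d d'"
          unfolding P_def using d t M(1) by (intro pw_doubling) auto
        moreover have "0 < pw \<bar>t\<bar> d d'" using t M by (intro pw_pos) auto
        ultimately have "1 / pw \<bar>t\<bar> d d' \<le> 2 powr (d + d') / P" using P by (simp add: field_simps)
        then show ?thesis
          using power_mono[of "1 / pw \<bar>t\<bar> d d'" "2 powr (d + d') / P" 2] pw_nonneg
          by (simp add: K1_def power_divide)
      qed
      then have "(\<integral>\<^sup>+ t\<in>{\<alpha>..\<beta>}. ennreal ((1 / pw \<bar>t\<bar> d d')\<^sup>2) \<partial>lborel) \<le> ennreal (K1 / P\<^sup>2 * (\<beta> - \<alpha>))"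
        using ab K by (intro nn_integral_le_const) auto
      moreover have "(\<beta> - \<alpha>) * (K1 / P\<^sup>2 * (\<beta> - \<alpha>)) \<le> (K1 + K2) * (F \<beta> - F \<alpha>)\<^sup>2"
      proof -
        have "(\<beta> - \<alpha>) * (K1 / P\<^sup>2 * (\<beta> - \<alpha>)) = K1 * ((\<beta> - \<alpha>) / P)\<^sup>2"
          by (simp add: power_divide power2_eq_square)
        also have "\<dots> \<le> (K1 + K2) * (F \<beta> - F \<alpha>)\<^sup>2"
          using len len0 K by (intro mult_mono power_mono) auto
        finally show ?thesis .
      qed
      ultimately show ?thesis by blast
    next
      case False
      then obtain t0 where t0: "t0 \<in> {\<alpha>..\<beta>}" "\<bar>t0\<bar> < M / 2" by auto
      have half: "M / 2 \<le> \<beta> - \<alpha>" using t0 unfolding M_def by (auto simp: max_def abs_if split: if_splits)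
      have MB: "M \<le> B"
      proof (cases "M \<le> 1")
        case False
        have "M powr (1 - d') = M / P" using False by (simp add: P_def pw_def powr_diff)
        also have "\<dots> \<le> 2 * L" using divide_right_mono[OF half, of P] len L P by simp
        finally have "(M powr (1 - d')) powr (1 / (1 - d')) \<le> (2 * L) powr (1 / (1 - d'))"
          using d by (intro powr_mono2) auto
        then show ?thesis using d M by (simp add: B_def powr_powr)
      qed (use B in simp)
      define c where "c = (B * M powr d / P)\<^sup>2"
      have pt: "(1 / pw \<bar>t\<bar> d d')\<^sup>2 \<le> c * \<bar>t\<bar> powr (- (2 * d))" if "\<bar>t\<bar> \<le> M" "t \<noteq> 0" for t
      proof -
        have "P * \<bar>t\<bar> powr d \<le> B * (pw \<bar>t\<bar> d d' * M powr d)"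
          unfolding P_def using that MB B d assms by (intro pw_power_comparison) auto
        moreover have p: "0 < pw \<bar>t\<bar> d d'" using that by (intro pw_pos) auto
        ultimately have "1 / pw \<bar>t\<bar> d d' \<le> (B * M powr d / P) * \<bar>t\<bar> powr (- d)"
          using P that by (simp add: field_simps powr_minus)
        then have "(1 / pw \<bar>t\<bar> d d')\<^sup>2 \<le> ((B * M powr d / P) * \<bar>t\<bar> powr (- d))\<^sup>2"
          using p by (intro power_mono) auto
        also have "\<dots> = c * \<bar>t\<bar> powr (- (2 * d))"
          using that by (simp add: c_def power_mult_distrib power2_eq_square powr_add[symmetric])
        finally show ?thesis .
      qed
      have "(\<integral>\<^sup>+ t\<in>{\<alpha>..\<beta>}. ennreal ((1 / pw \<bar>t\<bar> d d')\<^sup>2) \<partial>lborel)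
        \<le> (\<integral>\<^sup>+ t. ennreal c * (ennreal (\<bar>t\<bar> powr (- (2 * d))) * indicator {-M..M} t) \<partial>lborel)"
      proof (intro nn_integral_mono_AE)
        have "AE t in lborel. t \<noteq> (0::real)" by (rule AE_lborel_singleton)
        then show "AE t in lborel. ennreal ((1 / pw \<bar>t\<bar> d d')\<^sup>2) * indicator {\<alpha>..\<beta>} t
          \<le> ennreal c * (ennreal (\<bar>t\<bar> powr (- (2 * d))) * indicator {-M..M} t)"
        proof eventually_elim
          case (elim t)
          then show ?case
            using M pt[of t] by (auto simp: indicator_def c_def ennreal_mult[symmetric] intro!: ennreal_leI)
        qed
      qed
      also have "\<dots> = ennreal c * (\<integral>\<^sup>+ t\<in>{-M..M}. ennreal (\<bar>t\<bar> powr (- (2 * d))) \<partial>lborel)"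
        by (intro nn_integral_cmult) measurable
      also have "\<dots> \<le> ennreal c * ennreal (2 * M powr (1 - 2 * d) / (1 - 2 * d))"
        using assms M by (intro mult_left_mono nn_integral_powr_le) auto
      also have "\<dots> = ennreal (c * (2 * M powr (1 - 2 * d) / (1 - 2 * d)))"
        using assms M by (subst ennreal_mult[symmetric]) (auto simp: c_def)
      finally have 1: "(\<integral>\<^sup>+ t\<in>{\<alpha>..\<beta>}. ennreal ((1 / pw \<bar>t\<bar> d d')\<^sup>2) \<partial>lborel)
        \<le> ennreal (c * (2 * M powr (1 - 2 * d) / (1 - 2 * d)))" .
      have "M powr (2 * d) * M powr (1 - 2 * d) = M"
        using M by (simp add: powr_add[symmetric])
      then have "c * (2 * M powr (1 - 2 * d) / (1 - 2 * d)) = 2 * B\<^sup>2 / (1 - 2 * d) * M / P\<^sup>2"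
        using M by (simp add: c_def power_mult_distrib power_divide power2_eq_square[of "M powr d"] powr_add[symmetric] mult_ac)
      then have "(\<beta> - \<alpha>) * (c * (2 * M powr (1 - 2 * d) / (1 - 2 * d))) = 2 * B\<^sup>2 / (1 - 2 * d) * ((\<beta> - \<alpha>) * M / P\<^sup>2)"
        by simp
      also have "\<dots> \<le> 2 * B\<^sup>2 / (1 - 2 * d) * (2 * ((\<beta> - \<alpha>) / P)\<^sup>2)"
      proof (intro mult_left_mono)
        have "(\<beta> - \<alpha>) * M / P\<^sup>2 \<le> (\<beta> - \<alpha>) * (2 * (\<beta> - \<alpha>)) / P\<^sup>2"
          using half ab by (intro divide_right_mono mult_left_mono) auto
        also have "\<dots> = 2 * ((\<beta> - \<alpha>) / P)\<^sup>2" by (simp add: power2_eq_square)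
        finally show "(\<beta> - \<alpha>) * M / P\<^sup>2 \<le> 2 * ((\<beta> - \<alpha>) / P)\<^sup>2" .
      qed (use assms in auto)
      also have "\<dots> = K2 * ((\<beta> - \<alpha>) / P)\<^sup>2"
        by (simp add: K2_def)
      also have "\<dots> \<le> (K1 + K2) * (F \<beta> - F \<alpha>)\<^sup>2"
        using len len0 K by (intro mult_mono power_mono) auto
      finally show ?thesis using 1 by blast
    qed
    then obtain Z where Z: "(\<integral>\<^sup>+ t\<in>{\<alpha>..\<beta>}. ennreal ((1 / pw \<bar>t\<bar> d d')\<^sup>2) \<partial>lborel) \<le> ennreal Z"
      "(\<beta> - \<alpha>) * Z \<le> (K1 + K2) * (F \<beta> - F \<alpha>)\<^sup>2" by blast
    have "ennreal (\<beta> - \<alpha>) * (\<integral>\<^sup>+ t\<in>{\<alpha>..\<beta>}. ennreal ((1 / pw \<bar>t\<bar> d d')\<^sup>2) \<partial>lborel)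
      \<le> ennreal (\<beta> - \<alpha>) * ennreal Z" by (intro mult_left_mono Z) auto
    also have "\<dots> = ennreal ((\<beta> - \<alpha>) * Z)" using ab by (simp add: ennreal_mult')
    also have "\<dots> \<le> ennreal ((K1 + K2) * (F \<beta> - F \<alpha>)\<^sup>2)" by (intro ennreal_leI Z)
    finally show "ennreal (\<beta> - \<alpha>) * (\<integral>\<^sup>+ t\<in>{\<alpha>..\<beta>}. ennreal ((1 / pw \<bar>t\<bar> d d')\<^sup>2) \<partial>lborel)
      \<le> ennreal ((K1 + K2) * (F \<beta> - F \<alpha>)\<^sup>2)" .
  qed
qed

section \<open>Lebesgue measure on pairs and Poincare inequalities without weights\<close>

definition emb :: "real \<times> (real ^ 'm) \<Rightarrow> 'm::finite pt" where
  "emb p = (\<chi> i. case i of None \<Rightarrow> fst p | Some j \<Rightarrow> snd p $ j)"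

lemma emb_nth [simp]: "emb p $ None = fst p" "emb p $ Some j = snd p $ j"
  by (simp_all add: emb_def)

lemma x1_emb [simp]: "x1 (emb p) = fst p"
  by (simp add: x1_def)

lemma x2_emb [simp]: "x2 (emb p) = snd p"
  by (simp add: x2_def vec_eq_iff)

lemma emb_x1_x2 [simp]: "emb (x1 x, x2 x) = x"
  by (simp add: vec_eq_iff x1_def x2_def emb_def split: option.split)

lemma linear_emb: "linear emb"
  by (rule linearI) (auto simp: emb_def vec_eq_iff split: option.split)

lemma linear_x2: "linear x2"
  by (rule linearI) (auto simp: x2_def vec_eq_iff)

lemma continuous_on_emb: "continuous_on S emb"
  by (rule linear_continuous_on[OF linear_conv_bounded_linear[THEN iffD1, OF linear_emb]])

lemma continuous_on_x1: "continuous_on S x1"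
  unfolding x1_def by (intro continuous_intros)

lemma continuous_on_x2: "continuous_on S x2"
  by (rule linear_continuous_on[OF linear_conv_bounded_linear[THEN iffD1, OF linear_x2]])

lemma measurable_emb [measurable]: "emb \<in> borel_measurable borel"
  by (intro borel_measurable_continuous_onI continuous_on_emb)

lemma measurable_x1 [measurable]: "x1 \<in> borel_measurable borel"
  by (intro borel_measurable_continuous_onI continuous_on_x1)

lemma measurable_x2 [measurable]: "x2 \<in> borel_measurable borel"
  by (intro borel_measurable_continuous_onI continuous_on_x2)

lemma sum_option: "(\<Sum>i\<in>UNIV. f i) = f None + (\<Sum>j\<in>UNIV. f (Some (j :: 'm::finite)))"
  by (simp add: UNIV_option_conv sum.reindex)

lemma prod_option: "(\<Prod>i\<in>UNIV. f i) = f None * (\<Prod>j\<in>UNIV. f (Some (j :: 'm::finite)))"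
  by (simp add: UNIV_option_conv prod.reindex)

lemma inner_pt: "x \<bullet> y = x1 x * x1 y + x2 x \<bullet> x2 y"
  by (simp add: inner_vec_def sum_option x1_def x2_def)

lemma prod_Basis_vec: "(\<Prod>b\<in>(Basis :: (real ^ 'n) set). f b) = (\<Prod>i\<in>UNIV. f (axis i 1))"
proof -
  have "bij_betw (\<lambda>i::'n. axis i (1::real)) UNIV Basis"
    by (auto simp: bij_betw_def inj_on_def axis_eq_axis Basis_vec_def)
  from prod.reindex_bij_betw[OF this, of f] show ?thesis by simp
qed

lemma lborel_emb: "distr lborel borel emb = (lborel :: ('m::finite) pt measure)"
proof (rule lborel_eqI[symmetric])
  fix l u :: "'m pt"
  assume *: "\<And>b. b \<in> Basis \<Longrightarrow> l \<bullet> b \<le> u \<bullet> b"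
  have lu: "l $ i \<le> u $ i" for i using *[of "axis i 1"] by (simp add: axis_in_Basis_iff inner_axis)
  have "emb p \<in> box l u \<longleftrightarrow> p \<in> box (x1 l) (x1 u) \<times> box (x2 l) (x2 u)" for p
    unfolding mem_box_cart split_option_all by (auto simp: mem_box_cart x1_def x2_def mem_Times_iff)
  then have "emb -` box l u = box (x1 l) (x1 u) \<times> box (x2 l) (x2 u)" by blast
  then have "emeasure (distr lborel borel emb) (box l u) =
    emeasure (lborel \<Otimes>\<^sub>M lborel) (box (x1 l) (x1 u) \<times> box (x2 l) (x2 u))"
    by (simp add: emeasure_distr lborel_prod)
  also have "\<dots> = emeasure lborel (box (x1 l) (x1 u)) * emeasure lborel (box (x2 l) (x2 u))"
    by (intro lborel.emeasure_pair_measure_Times) auto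
  also have "emeasure lborel (box (x1 l) (x1 u)) = ennreal (u $ None - l $ None)"
    using lu by (simp add: x1_def)
  also have "emeasure lborel (box (x2 l) (x2 u)) = ennreal (\<Prod>j\<in>UNIV. u $ Some j - l $ Some j)"
  proof (subst emeasure_lborel_box)
    show "x2 l \<bullet> b \<le> x2 u \<bullet> b" if "b \<in> Basis" for b
      using that lu by (auto simp: Basis_vec_def inner_axis x2_def)
  qed (simp add: prod_Basis_vec inner_axis x2_def)
  also have "ennreal (u $ None - l $ None) * ennreal (\<Prod>j\<in>UNIV. u $ Some j - l $ Some j) =
    ennreal (\<Prod>b\<in>Basis. (u - l) \<bullet> b)"
    using lu by (simp add: prod_Basis_vec prod_option inner_axis ennreal_mult prod_nonneg)
  finally show "emeasure (distr lborel borel emb) (box l u) = ennreal (\<Prod>b\<in>Basis. (u - l) \<bullet> b)" .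
qed simp

lemma nn_integral_pt:
  assumes [measurable]: "f \<in> borel_measurable borel"
  shows "(\<integral>\<^sup>+ x. f x \<partial>lborel) = (\<integral>\<^sup>+ t. \<integral>\<^sup>+ v. f (emb (t, v)) \<partial>lborel \<partial>lborel)"
proof -
  have "(\<integral>\<^sup>+ x. f x \<partial>lborel) = (\<integral>\<^sup>+ p. f (emb p) \<partial>lborel)"
    by (subst lborel_emb[symmetric]) (simp add: nn_integral_distr)
  also have "\<dots> = (\<integral>\<^sup>+ t. \<integral>\<^sup>+ v. f (emb (t, v)) \<partial>lborel \<partial>lborel)"
    by (subst lborel_prod[symmetric], subst lborel.nn_integral_fst[symmetric])
       (simp_all add: lborel_prod)
  finally show ?thesis .
qed

lemma ex_le_average:
  assumes [measurable]: "S \<in> sets M" "h \<in> borel_measurable M"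
    and S: "emeasure M S \<noteq> 0" "emeasure M S \<noteq> \<infinity>"
  shows "\<exists>z\<in>S. emeasure M S * h z \<le> (\<integral>\<^sup>+ x\<in>S. h x \<partial>M)"
proof (rule ccontr)
  define E where "E = (\<integral>\<^sup>+ x\<in>S. h x \<partial>M)"
  assume "\<not> ?thesis"
  then have gt: "E < emeasure M S * h z" if "z \<in> S" for z using that by (auto simp: E_def not_le)
  have "S \<noteq> {}" using S by auto
  then obtain z0 where "z0 \<in> S" by blast
  from gt[OF this] have E: "E \<noteq> \<infinity>" by auto
  have less: "E / emeasure M S < h z" if "z \<in> S" for z
  proof (rule ccontr)
    assume "\<not> E / emeasure M S < h z"
    then have "emeasure M S * h z \<le> emeasure M S * (E / emeasure M S)"
      by (intro mult_left_mono) auto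
    also have "\<dots> = E" using S by (simp add: ennreal_mult_divide_eq ennreal_times_divide mult.commute)
    finally show False using gt[OF that] by simp
  qed
  have const: "(\<integral>\<^sup>+ x. E / emeasure M S * indicator S x \<partial>M) = E"
    using S by (subst nn_integral_cmult_indicator) (simp_all add: ennreal_divide_times ennreal_divide_self less_top)
  have "(\<integral>\<^sup>+ x. E / emeasure M S * indicator S x \<partial>M) < (\<integral>\<^sup>+ x. h x * indicator S x \<partial>M)"
  proof (rule nn_integral_less)
    show "(\<integral>\<^sup>+ x. E / emeasure M S * indicator S x \<partial>M) \<noteq> \<infinity>"
      using E const by simp
    show "AE x in M. E / emeasure M S * indicator S x \<le> h x * indicator S x"
      using less by (auto simp: indicator_def intro!: AE_I2 less_imp_le)
    show "\<not> (AE x in M. h x * indicator S x \<le> E / emeasure M S * indicator S x)"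
    proof
      assume "AE x in M. h x * indicator S x \<le> E / emeasure M S * indicator S x"
      then have "AE x in M. x \<notin> S"
        by (rule AE_mp, intro AE_I2) (use less in \<open>force simp: indicator_def not_le[symmetric]\<close>)
      then show False using S(1) AE_iff_measurable[of S M "\<lambda>x. x \<notin> S"] sets.sets_into_space[of S M]
        by (auto simp: Int_absorb1 Collect_conj_eq)
    qed
  qed measurable
  also have "\<dots> = E" by (simp add: E_def)
  finally show False using const by simp
qed

lemma weighted_increment:
  fixes h h' w :: "real \<Rightarrow> real"
  assumes deriv: "\<And>t. (h has_real_derivative h' t) (at t)" and cont: "continuous_on UNIV h'"
    and [measurable]: "w \<in> borel_measurable borel" and w: "\<And>t. t \<noteq> 0 \<Longrightarrow> 0 < w t"
    and st: "s \<in> {\<alpha>..\<beta>}" "t \<in> {\<alpha>..\<beta>}"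
  shows "ennreal ((h t - h s)\<^sup>2) \<le>
    (\<integral>\<^sup>+ x\<in>{\<alpha>..\<beta>}. ennreal ((1 / w x)\<^sup>2) \<partial>lborel) * (\<integral>\<^sup>+ x\<in>{\<alpha>..\<beta>}. ennreal ((w x * h' x)\<^sup>2) \<partial>lborel)"
proof -
  have [measurable]: "h' \<in> borel_measurable borel"
    using cont by (rule borel_measurable_continuous_onI)
  have incr: "ennreal \<bar>h q - h p\<bar> \<le> (\<integral>\<^sup>+ x\<in>{\<alpha>..\<beta>}. ennreal \<bar>h' x\<bar> \<partial>lborel)"
    if "p \<le> q" "p \<in> {\<alpha>..\<beta>}" "q \<in> {\<alpha>..\<beta>}" for p q
  proof -
    have I: "(h' has_integral (h q - h p)) {p..q}"
      using that(1) deriv by (intro fundamental_theorem_of_calculus)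
        (auto simp: has_real_derivative_iff_has_vector_derivative intro: has_vector_derivative_at_within)
    have J: "(\<lambda>x. \<bar>h' x\<bar>) integrable_on {p..q}"
      by (intro integrable_continuous_real continuous_intros continuous_on_subset[OF cont]) auto
    have "\<bar>h q - h p\<bar> \<le> integral {p..q} (\<lambda>x. \<bar>h' x\<bar>)"
      using integral_norm_bound_integral[OF has_integral_integrable[OF I] J] integral_unique[OF I] by simp
    then have "ennreal \<bar>h q - h p\<bar> \<le> ennreal (integral {p..q} (\<lambda>x. \<bar>h' x\<bar>))" by (rule ennreal_leI)
    also have "\<dots> = (\<integral>\<^sup>+ x. ennreal \<bar>h' x\<bar> * indicator {p..q} x \<partial>lborel)"
      by (rule nn_integral_has_integral_lebesgue'[symmetric]) (use J in \<open>auto simp: integrable_integral\<close>)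
    also have "\<dots> \<le> (\<integral>\<^sup>+ x\<in>{\<alpha>..\<beta>}. ennreal \<bar>h' x\<bar> \<partial>lborel)"
      using that by (intro nn_integral_mono) (auto simp: indicator_def)
    finally show ?thesis .
  qed
  have "ennreal \<bar>h t - h s\<bar> \<le> (\<integral>\<^sup>+ x\<in>{\<alpha>..\<beta>}. ennreal \<bar>h' x\<bar> \<partial>lborel)"
    using incr[of s t] incr[of t s] st by (cases "s \<le> t") (auto simp: abs_minus_commute)
  also have "\<dots> = (\<integral>\<^sup>+ x. (ennreal (1 / \<bar>w x\<bar>) * indicator {\<alpha>..\<beta>} x) * (ennreal \<bar>w x * h' x\<bar> * indicator {\<alpha>..\<beta>} x) \<partial>lborel)"
  proof (intro nn_integral_cong_AE)
    have "AE x in lborel. x \<noteq> (0::real)" by (rule AE_lborel_singleton)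
    then show "AE x in lborel. ennreal \<bar>h' x\<bar> * indicator {\<alpha>..\<beta>} x =
      (ennreal (1 / \<bar>w x\<bar>) * indicator {\<alpha>..\<beta>} x) * (ennreal \<bar>w x * h' x\<bar> * indicator {\<alpha>..\<beta>} x)"
    proof eventually_elim
      case (elim x)
      then show ?case using w[of x] by (auto simp: indicator_def ennreal_mult[symmetric] abs_mult)
    qed
  qed
  finally have "(ennreal \<bar>h t - h s\<bar>)\<^sup>2 \<le> \<dots>\<^sup>2" by (intro power_mono) auto
  also have "\<dots> \<le> (\<integral>\<^sup>+ x. (ennreal (1 / \<bar>w x\<bar>) * indicator {\<alpha>..\<beta>} x)\<^sup>2 \<partial>lborel) *
      (\<integral>\<^sup>+ x. (ennreal \<bar>w x * h' x\<bar> * indicator {\<alpha>..\<beta>} x)\<^sup>2 \<partial>lborel)"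
    by (intro Cauchy_Schwarz_nn_integral) measurable
  also have "\<dots> = (\<integral>\<^sup>+ x\<in>{\<alpha>..\<beta>}. ennreal ((1 / w x)\<^sup>2) \<partial>lborel) * (\<integral>\<^sup>+ x\<in>{\<alpha>..\<beta>}. ennreal ((w x * h' x)\<^sup>2) \<partial>lborel)"
    by (intro arg_cong2[where f = "(*)"] nn_integral_cong)
       (auto simp: indicator_def ennreal_power power_divide)
  finally show ?thesis by (simp add: ennreal_power)
qed

lemma nn_integral_affine_le:
  fixes G :: "'a::euclidean_space \<Rightarrow> ennreal"
  assumes [measurable]: "G \<in> borel_measurable borel" and c: "1/2 \<le> c"
  shows "(\<integral>\<^sup>+ y. G (p + c *\<^sub>R y) \<partial>lborel) \<le> 2 ^ DIM('a) * (\<integral>\<^sup>+ y. G y \<partial>lborel)"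
proof -
  have "c \<noteq> 0" using c by auto
  have "1 \<le> (2 * c) ^ DIM('a)" using c by (intro one_le_power) auto
  then have "1 \<le> ennreal ((2 * c) ^ DIM('a))" by (simp add: ennreal_leI flip: ennreal_1)
  also have "\<dots> = 2 ^ DIM('a) * ennreal (\<bar>c\<bar> ^ DIM('a))"
    using c by (simp add: power_mult_distrib ennreal_mult flip: ennreal_power)
  finally have "1 * (\<integral>\<^sup>+ y. G (p + c *\<^sub>R y) \<partial>lborel) \<le>
      (2 ^ DIM('a) * ennreal (\<bar>c\<bar> ^ DIM('a))) * (\<integral>\<^sup>+ y. G (p + c *\<^sub>R y) \<partial>lborel)"
    by (intro mult_right_mono) auto
  moreover have "(\<integral>\<^sup>+ y. G y \<partial>lborel) = ennreal (\<bar>c\<bar> ^ DIM('a)) * (\<integral>\<^sup>+ y. G (p + c *\<^sub>R y) \<partial>lborel)"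
    by (subst lborel_affine[OF \<open>c \<noteq> 0\<close>, of p]) (simp add: nn_integral_density nn_integral_distr nn_integral_cmult)
  ultimately show ?thesis by (simp add: mult.assoc)
qed

lemma convex_Poincare:
  fixes f :: "'a::euclidean_space \<Rightarrow> real" and g :: "'a \<Rightarrow> 'a"
  assumes deriv: "\<And>x. (f has_derivative (\<lambda>h. g x \<bullet> h)) (at x)" and cont: "continuous_on UNIV g"
    and S [measurable]: "S \<in> sets borel" and conv: "convex S"
    and diam: "\<And>x y. x \<in> S \<Longrightarrow> y \<in> S \<Longrightarrow> norm (y - x) \<le> D" and D: "0 \<le> D"
  shows "(\<integral>\<^sup>+ x\<in>S. (\<integral>\<^sup>+ y\<in>S. ennreal ((f y - f x)\<^sup>2) \<partial>lborel) \<partial>lborel) \<le>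
    ennreal (D\<^sup>2) * 2 ^ DIM('a) * emeasure lborel S * (\<integral>\<^sup>+ x\<in>S. ennreal ((norm (g x))\<^sup>2) \<partial>lborel)"
proof -
  have [measurable]: "g \<in> borel_measurable borel"
    using cont by (rule borel_measurable_continuous_onI)
  define G where "G x = ennreal ((norm (g x))\<^sup>2) * indicator S x" for x
  have [measurable]: "G \<in> borel_measurable borel" unfolding G_def by measurable
  define I where "I s = (indicator {0..1} s :: ennreal)" for s :: real
  have [measurable]: "I \<in> borel_measurable borel" unfolding I_def by measurable
  have seg: "ennreal ((f y - f x)\<^sup>2) \<le> ennreal (D\<^sup>2) * (\<integral>\<^sup>+ s. G ((1 - s) *\<^sub>R x + s *\<^sub>R y) * I s \<partial>lborel)"
    if "x \<in> S" "y \<in> S" for x y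
  proof -
    define p where "p s = (1 - s) *\<^sub>R x + s *\<^sub>R y" for s :: real
    have pS: "p s \<in> S" if "s \<in> {0..1}" for s
      unfolding p_def using conv that \<open>x \<in> S\<close> \<open>y \<in> S\<close> by (auto simp: convex_alt)
    have 1: "((\<lambda>s. f (p s)) has_real_derivative g (p s) \<bullet> (y - x)) (at s)" for s
    proof -
      have "(p has_derivative (\<lambda>h. h *\<^sub>R (y - x))) (at s)"
        unfolding p_def by (auto intro!: derivative_eq_intros simp: algebra_simps)
      from has_derivative_compose[OF this deriv]
      show ?thesis by (simp add: has_field_derivative_def mult_commute_abs)
    qed
    have pc: "continuous_on UNIV p" unfolding p_def by (intro continuous_intros)
    have 2: "continuous_on UNIV (\<lambda>s. g (p s) \<bullet> (y - x))"
      using continuous_on_compose2[OF cont pc] by (intro continuous_intros) auto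
    have "ennreal ((f (p 1) - f (p 0))\<^sup>2) \<le>
      (\<integral>\<^sup>+ s\<in>{0..1::real}. ennreal ((1 / 1)\<^sup>2) \<partial>lborel) * (\<integral>\<^sup>+ s\<in>{0..1}. ennreal ((1 * (g (p s) \<bullet> (y - x)))\<^sup>2) \<partial>lborel)"
      by (rule weighted_increment[OF 1 2]) auto
    also have "(\<integral>\<^sup>+ s\<in>{0..1::real}. ennreal ((1 / 1)\<^sup>2) \<partial>lborel) = 1" by simp
    also have "1 * (\<integral>\<^sup>+ s\<in>{0..1}. ennreal ((1 * (g (p s) \<bullet> (y - x)))\<^sup>2) \<partial>lborel) \<le>
        (\<integral>\<^sup>+ s. ennreal (D\<^sup>2) * (G (p s) * I s) \<partial>lborel)"
      unfolding mult_1
    proof (rule nn_integral_mono)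
      fix s :: real
      show "ennreal ((g (p s) \<bullet> (y - x))\<^sup>2) * indicator {0..1} s \<le> ennreal (D\<^sup>2) * (G (p s) * I s)"
      proof (cases "s \<in> {0..1}")
        case True
        have "\<bar>g (p s) \<bullet> (y - x)\<bar> \<le> norm (g (p s)) * norm (y - x)" by (rule Cauchy_Schwarz_ineq2)
        also have "\<dots> \<le> norm (g (p s)) * D" using diam[OF that] by (intro mult_left_mono) auto
        finally have "(g (p s) \<bullet> (y - x))\<^sup>2 \<le> (norm (g (p s)) * D)\<^sup>2"
          using D by (metis abs_ge_zero power2_abs power_mono)
        then show ?thesis using True pS[OF True]
          by (simp add: I_def G_def ennreal_mult[symmetric] power_mult_distrib mult.commute ennreal_leI)
      qed (simp add: I_def)
    qed
    also have "\<dots> = ennreal (D\<^sup>2) * (\<integral>\<^sup>+ s. G (p s) * I s \<partial>lborel)"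
      by (rule nn_integral_cmult) (simp add: p_def)
    finally show ?thesis by (simp add: p_def)
  qed
  define N where "N = (\<integral>\<^sup>+ x. G x \<partial>lborel)"
  have slice: "(\<integral>\<^sup>+ x. \<integral>\<^sup>+ y. G ((1 - s) *\<^sub>R x + s *\<^sub>R y) * (indicator S x * indicator S y) \<partial>lborel \<partial>lborel) \<le>
      2 ^ DIM('a) * emeasure lborel S * N" for s
  proof -
    have *: "(\<integral>\<^sup>+ x. \<integral>\<^sup>+ y. G (c' *\<^sub>R x + c *\<^sub>R y) * (indicator S x * indicator S y) \<partial>lborel \<partial>lborel) \<le>
      2 ^ DIM('a) * emeasure lborel S * N" if "1/2 \<le> c" for c c'
    proof -
      have "(\<integral>\<^sup>+ x. \<integral>\<^sup>+ y. G (c' *\<^sub>R x + c *\<^sub>R y) * (indicator S x * indicator S y) \<partial>lborel \<partial>lborel) \<le>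
        (\<integral>\<^sup>+ x. (2 ^ DIM('a) * N) * indicator S x \<partial>lborel)"
      proof (rule nn_integral_mono)
        fix x
        have "(\<integral>\<^sup>+ y. G (c' *\<^sub>R x + c *\<^sub>R y) * (indicator S x * indicator S y) \<partial>lborel) \<le>
          (\<integral>\<^sup>+ y. G (c' *\<^sub>R x + c *\<^sub>R y) * indicator S x \<partial>lborel)"
          by (intro nn_integral_mono) (auto simp: indicator_def)
        also have "\<dots> = (\<integral>\<^sup>+ y. G (c' *\<^sub>R x + c *\<^sub>R y) \<partial>lborel) * indicator S x"
          by (intro nn_integral_multc) measurable
        also have "\<dots> \<le> (2 ^ DIM('a) * N) * indicator S x"
          unfolding N_def by (intro mult_right_mono nn_integral_affine_le that) auto
        finally show "(\<integral>\<^sup>+ y. G (c' *\<^sub>R x + c *\<^sub>R y) * (indicator S x * indicator S y) \<partial>lborel) \<le>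
          (2 ^ DIM('a) * N) * indicator S x" .
      qed
      also have "\<dots> = 2 ^ DIM('a) * emeasure lborel S * N"
        by (subst nn_integral_cmult_indicator) (simp_all add: mult_ac)
      finally show ?thesis .
    qed
    show ?thesis
    proof (cases "1/2 \<le> s")
      case True
      then show ?thesis by (rule *)
    next
      case False
      have "(\<integral>\<^sup>+ x. \<integral>\<^sup>+ y. G ((1 - s) *\<^sub>R x + s *\<^sub>R y) * (indicator S x * indicator S y) \<partial>lborel \<partial>lborel) =
        (\<integral>\<^sup>+ y. \<integral>\<^sup>+ x. G ((1 - s) *\<^sub>R x + s *\<^sub>R y) * (indicator S x * indicator S y) \<partial>lborel \<partial>lborel)"
        by (rule lborel_pair.Fubini') measurable
      also have "\<dots> = (\<integral>\<^sup>+ y. \<integral>\<^sup>+ x. G (s *\<^sub>R y + (1 - s) *\<^sub>R x) * (indicator S y * indicator S x) \<partial>lborel \<partial>lborel)"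
        by (simp add: add.commute mult.commute)
      also have "\<dots> \<le> 2 ^ DIM('a) * emeasure lborel S * N" using False by (intro *) simp
      finally show ?thesis .
    qed
  qed
  have "(\<integral>\<^sup>+ x\<in>S. (\<integral>\<^sup>+ y\<in>S. ennreal ((f y - f x)\<^sup>2) \<partial>lborel) \<partial>lborel) \<le>
    (\<integral>\<^sup>+ x. \<integral>\<^sup>+ y. ennreal (D\<^sup>2) * (\<integral>\<^sup>+ s. G ((1 - s) *\<^sub>R x + s *\<^sub>R y) * I s * (indicator S x * indicator S y) \<partial>lborel) \<partial>lborel \<partial>lborel)"
  proof (rule nn_integral_mono)
    fix x
    show "(\<integral>\<^sup>+ y\<in>S. ennreal ((f y - f x)\<^sup>2) \<partial>lborel) * indicator S x \<le>
      (\<integral>\<^sup>+ y. ennreal (D\<^sup>2) * (\<integral>\<^sup>+ s. G ((1 - s) *\<^sub>R x + s *\<^sub>R y) * I s * (indicator S x * indicator S y) \<partial>lborel) \<partial>lborel)"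
      by (cases "x \<in> S") (auto intro!: nn_integral_mono seg simp: indicator_def)
  qed
  also have "\<dots> = ennreal (D\<^sup>2) * (\<integral>\<^sup>+ x. \<integral>\<^sup>+ y. \<integral>\<^sup>+ s. G ((1 - s) *\<^sub>R x + s *\<^sub>R y) * I s * (indicator S x * indicator S y) \<partial>lborel \<partial>lborel \<partial>lborel)"
    by (simp add: nn_integral_cmult)
  also have "(\<integral>\<^sup>+ x. \<integral>\<^sup>+ y. \<integral>\<^sup>+ s. G ((1 - s) *\<^sub>R x + s *\<^sub>R y) * I s * (indicator S x * indicator S y) \<partial>lborel \<partial>lborel \<partial>lborel) =
    (\<integral>\<^sup>+ x. \<integral>\<^sup>+ s. \<integral>\<^sup>+ y. G ((1 - s) *\<^sub>R x + s *\<^sub>R y) * I s * (indicator S x * indicator S y) \<partial>lborel \<partial>lborel \<partial>lborel)"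
    by (intro nn_integral_cong lborel_pair.Fubini') measurable
  also have "\<dots> = (\<integral>\<^sup>+ s. \<integral>\<^sup>+ x. \<integral>\<^sup>+ y. G ((1 - s) *\<^sub>R x + s *\<^sub>R y) * I s * (indicator S x * indicator S y) \<partial>lborel \<partial>lborel \<partial>lborel)"
    by (intro lborel_pair.Fubini') measurable
  also have "\<dots> = (\<integral>\<^sup>+ s. (\<integral>\<^sup>+ x. \<integral>\<^sup>+ y. G ((1 - s) *\<^sub>R x + s *\<^sub>R y) * (indicator S x * indicator S y) \<partial>lborel \<partial>lborel) * I s \<partial>lborel)"
    by (intro nn_integral_cong) (auto simp: I_def indicator_def)
  also have "\<dots> \<le> (\<integral>\<^sup>+ s. (2 ^ DIM('a) * emeasure lborel S * N) * I s \<partial>lborel)"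
    by (intro nn_integral_mono mult_right_mono slice) auto
  also have "\<dots> = 2 ^ DIM('a) * emeasure lborel S * N"
    by (simp add: I_def nn_integral_cmult_indicator)
  finally show ?thesis by (simp add: N_def G_def mult.assoc mult_left_mono)
qed

lemma nn_integral_avg_le:
  fixes \<phi> :: "'m::finite pt \<Rightarrow> real"
  assumes cont: "continuous_on UNIV \<phi>" and B [measurable]: "B \<in> sets borel" and bdd: "bounded B"
  shows "(\<integral>\<^sup>+ y\<in>B. ennreal ((\<phi> y - avg \<phi> B)\<^sup>2) \<partial>lebesgue) \<le> (\<integral>\<^sup>+ y\<in>B. ennreal ((\<phi> y - c)\<^sup>2) \<partial>lebesgue)"
proof -
  obtain K where K: "compact K" "B \<subseteq> K"
    using bdd compact_cbox bounded_subset_cbox_symmetric by metis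
  have int: "integrable lebesgue (\<lambda>x. indicator B x * p x)" if "continuous_on UNIV p" for p :: "'m pt \<Rightarrow> real"
  proof -
    have "set_integrable lborel K p"
      unfolding set_integrable_def using K that by (intro borel_integrable_compact) (auto intro: continuous_on_subset)
    then have "set_integrable lborel B p" using K B by (rule_tac set_integrable_subset) auto
    then have "integrable lborel (\<lambda>x. indicator B x * p x)" by (simp add: set_integrable_def)
    then show ?thesis by (subst integrable_completion) auto
  qed
  define V where "V = measure lebesgue B"
  define A where "A = avg \<phi> B"
  have nn: "(\<integral>\<^sup>+ y\<in>B. ennreal ((\<phi> y - e)\<^sup>2) \<partial>lebesgue) = ennreal (\<integral>y. indicator B y * (\<phi> y - e)\<^sup>2 \<partial>lebesgue)" for e
  proof -
    have "(\<integral>\<^sup>+ y\<in>B. ennreal ((\<phi> y - e)\<^sup>2) \<partial>lebesgue) = (\<integral>\<^sup>+ y. ennreal (indicator B y * (\<phi> y - e)\<^sup>2) \<partial>lebesgue)"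
      by (intro nn_integral_cong) (auto simp: indicator_def)
    also have "\<dots> = ennreal (\<integral>y. indicator B y * (\<phi> y - e)\<^sup>2 \<partial>lebesgue)"
      using cont by (intro nn_integral_eq_integral int continuous_intros) auto
    finally show ?thesis .
  qed
  define i0 where "i0 = (\<integral>y. indicator B y * \<phi> y \<partial>lebesgue)"
  define i2 where "i2 = (\<integral>y. indicator B y * (\<phi> y)\<^sup>2 \<partial>lebesgue)"
  have exp: "(\<integral>y. indicator B y * (\<phi> y - e)\<^sup>2 \<partial>lebesgue) = i2 - 2 * e * i0 + e\<^sup>2 * V" for e
  proof -
    have "(\<integral>y. indicator B y * (\<phi> y - e)\<^sup>2 \<partial>lebesgue) =
      (\<integral>y. indicator B y * (\<phi> y)\<^sup>2 - 2 * e * (indicator B y * \<phi> y) + e\<^sup>2 * (indicator B y * 1) \<partial>lebesgue)"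
      by (intro Bochner_Integration.integral_cong) (auto simp: power2_eq_square algebra_simps)
    also have "\<dots> = i2 - 2 * e * i0 + e\<^sup>2 * (\<integral>y. indicator B y * 1 \<partial>lebesgue)"
      unfolding i0_def i2_def using int[of "\<lambda>_. 1"] int[of \<phi>] int[of "\<lambda>y. (\<phi> y)\<^sup>2"] cont
      by (simp add: continuous_on_power)
    also have "(\<integral>y. indicator B y * 1 \<partial>lebesgue) = V" by (simp add: V_def)
    finally show ?thesis .
  qed
  have A: "A = i0 / V" by (simp add: A_def avg_def i0_def V_def set_lebesgue_integral_def)
  show ?thesis
  proof (cases "V = 0")
    case True
    have "emeasure lebesgue B < \<infinity>"
      using bdd emeasure_bounded_finite[OF bdd] by simp
    then have "emeasure lebesgue B = 0" using True by (auto simp: V_def measure_def enn2real_eq_0_iff)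
    then have "AE x in lebesgue. x \<notin> B" by (intro AE_not_in) (simp add: null_sets_def)
    then have "(\<integral>\<^sup>+ y\<in>B. ennreal ((\<phi> y - avg \<phi> B)\<^sup>2) \<partial>lebesgue) = (\<integral>\<^sup>+ y. 0 \<partial>(lebesgue :: 'm pt measure))"
      by (intro nn_integral_cong_AE) (auto simp: indicator_def)
    then show ?thesis by simp
  next
    case False
    have "0 \<le> V" by (simp add: V_def)
    have "i2 - 2 * A * i0 + A\<^sup>2 * V + V * (A - c)\<^sup>2 = i2 - 2 * c * i0 + c\<^sup>2 * V"
      using False A by (simp add: power2_eq_square algebra_simps)
    moreover have "0 \<le> V * (A - c)\<^sup>2" using \<open>0 \<le> V\<close> by simp
    ultimately show ?thesis unfolding nn exp A_def[symmetric] by (intro ennreal_leI) linarith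
  qed
qed

section \<open>Intrinsic distance and slabs\<close>

lemma C1_has_derivative:
  assumes "\<phi> \<in> C1"
  shows "(\<phi> has_derivative (\<lambda>h. grad \<phi> x \<bullet> h)) (at x)"
proof -
  let ?L = "frechet_derivative \<phi> (at x)"
  have L: "(\<phi> has_derivative ?L) (at x)"
    using assms by (simp add: C1_def frechet_derivative_works)
  then interpret bounded_linear ?L by (rule has_derivative_bounded_linear)
  have "?L h = grad \<phi> x \<bullet> h" for h
  proof -
    have "?L h = ?L (\<Sum>i\<in>UNIV. (h $ i) *\<^sub>R axis i 1)"
      using basis_expansion[of h] by (simp add: scalar_mult_eq_scaleR)
    also have "\<dots> = (\<Sum>i\<in>UNIV. h $ i * ?L (axis i 1))" by (simp add: sum scaleR)
    also have "\<dots> = grad \<phi> x \<bullet> h" by (simp add: grad_def inner_vec_def mult.commute)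
    finally show ?thesis .
  qed
  then have "?L = (\<lambda>h. grad \<phi> x \<bullet> h)" by (rule ext)
  then show ?thesis using L by simp
qed

lemma grad_eqI:
  assumes "(\<phi> has_derivative (\<lambda>h. g \<bullet> h)) (at x)"
  shows "grad \<phi> x = g"
proof -
  have "frechet_derivative \<phi> (at x) = (\<lambda>h. g \<bullet> h)"
    using frechet_derivative_at[OF assms] by simp
  then show ?thesis by (simp add: grad_def vec_eq_iff inner_axis)
qed

lemma continuous_on_grad:
  assumes "\<phi> \<in> C1"
  shows "continuous_on S (grad \<phi>)"
proof -
  have "continuous_on UNIV (\<lambda>x. \<chi> i. grad \<phi> x $ i)"
    using assms unfolding C1_def by (intro continuous_on_vec_lambda) auto
  then show ?thesis using continuous_on_subset by (simp, blast)
qed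

lemma C1_I:
  assumes "\<And>x. (\<phi> has_derivative (\<lambda>h. g x \<bullet> h)) (at x)" "continuous_on UNIV g"
  shows "\<phi> \<in> C1"
proof -
  have "grad \<phi> x = g x" for x using grad_eqI[OF assms(1)] .
  moreover have "\<phi> differentiable (at x)" for x using assms(1) unfolding differentiable_def by blast
  ultimately show ?thesis
    using assms(2) by (auto simp: C1_def intro!: continuous_intros)
qed

lemma C1_continuous_on: "\<phi> \<in> C1 \<Longrightarrow> continuous_on S \<phi>"
  by (meson C1_has_derivative has_derivative_continuous continuous_at_imp_continuous_on)

lemma C1_deriv_x1:
  assumes "\<phi> \<in> C1"
  shows "((\<lambda>t. \<phi> (emb (t, v))) has_real_derivative x1 (grad \<phi> (emb (t, v)))) (at t)"
proof -
  have "((\<lambda>t. emb (t, v)) has_derivative (\<lambda>h. emb (h, 0))) (at t)"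
    by (rule bounded_linear.has_derivative[OF linear_conv_bounded_linear[THEN iffD1, OF linear_emb]
          has_derivative_Pair[OF has_derivative_ident has_derivative_const]])
  from has_derivative_compose[OF this C1_has_derivative[OF assms]]
  show ?thesis by (simp add: has_field_derivative_def inner_pt)
qed

lemma C1_deriv_x2:
  assumes "\<phi> \<in> C1"
  shows "((\<lambda>v. \<phi> (emb (t, v))) has_derivative (\<lambda>h. x2 (grad \<phi> (emb (t, v))) \<bullet> h)) (at v)"
proof -
  have "((\<lambda>v. emb (t, v)) has_derivative (\<lambda>h. emb (0, h))) (at v)"
    by (rule bounded_linear.has_derivative[OF linear_conv_bounded_linear[THEN iffD1, OF linear_emb]
          has_derivative_Pair[OF has_derivative_const has_derivative_ident]])
  from has_derivative_compose[OF this C1_has_derivative[OF assms]]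
  show ?thesis by (simp add: inner_pt)
qed

lemma Gamma_Cdelta:
  "Gamma (Cdelta d1 d1' d2 d2') \<phi> x =
    (pw \<bar>x1 x\<bar> d1 d1' * x1 (grad \<phi> x))\<^sup>2 + (pw \<bar>x1 x\<bar> d2 d2' * norm (x2 (grad \<phi> x)))\<^sup>2"
proof -
  define A where "A = Cdelta d1 d1' d2 d2' x"
  define \<xi> where "\<xi> = grad \<phi> x"
  have "(A *v \<xi>) $ i = (if i = None then (pw \<bar>x1 x\<bar> d1 d1')\<^sup>2 else (pw \<bar>x1 x\<bar> d2 d2')\<^sup>2) * \<xi> $ i" for i
  proof -
    have "(A *v \<xi>) $ i = (\<Sum>j\<in>UNIV. if i = j then (if i = None then (pw \<bar>x1 x\<bar> d1 d1')\<^sup>2 else (pw \<bar>x1 x\<bar> d2 d2')\<^sup>2) * \<xi> $ i else 0)"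
      unfolding matrix_vector_mult_def A_def Cdelta_def pw_double vec_lambda_beta by (intro sum.cong refl) simp
    also have "\<dots> = (if i = None then (pw \<bar>x1 x\<bar> d1 d1')\<^sup>2 else (pw \<bar>x1 x\<bar> d2 d2')\<^sup>2) * \<xi> $ i"
      by (subst sum.delta') simp_all
    finally show ?thesis .
  qed
  then have "x1 (A *v \<xi>) = (pw \<bar>x1 x\<bar> d1 d1')\<^sup>2 * x1 \<xi>" "x2 (A *v \<xi>) = (pw \<bar>x1 x\<bar> d2 d2')\<^sup>2 *\<^sub>R x2 \<xi>"
    by (simp_all add: x1_def x2_def vec_eq_iff)
  then show ?thesis
    by (simp add: Gamma_def A_def[symmetric] \<xi>_def[symmetric] inner_pt power_mult_distrib power2_norm_eq_inner)
      (simp add: power2_eq_square)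
qed

lemma continuous_on_Gamma_Cdelta:
  assumes "\<phi> \<in> C1" "0 \<le> d1" "0 \<le> d1'" "0 \<le> d2" "0 \<le> d2'"
  shows "continuous_on UNIV (Gamma (Cdelta d1 d1' d2 d2') \<phi>)"
proof -
  have "continuous_on UNIV (\<lambda>x. (pw \<bar>x1 x\<bar> d1 d1' * x1 (grad \<phi> x))\<^sup>2 + (pw \<bar>x1 x\<bar> d2 d2' * norm (x2 (grad \<phi> x)))\<^sup>2)"
    by (intro continuous_intros continuous_on_pw_abs continuous_on_x1 assms
        continuous_on_compose2[OF continuous_on_x1 continuous_on_grad[OF assms(1)]]
        continuous_on_compose2[OF continuous_on_x2 continuous_on_grad[OF assms(1)]]) auto
  then show ?thesis by (simp add: Gamma_Cdelta[abs_def])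
qed

lemma AE_le_imp_le:
  fixes f :: "'a::euclidean_space \<Rightarrow> real"
  assumes "continuous_on UNIV f" "AE x in lebesgue. f x \<le> c"
  shows "f x \<le> c"
proof (rule ccontr)
  assume "\<not> f x \<le> c"
  have "open {x. c < f x}"
    using assms(1) by (intro open_Collect_less continuous_intros) auto
  then have "\<not> negligible {x. c < f x}"
    using \<open>\<not> f x \<le> c\<close> by (intro open_not_negligible) (auto simp: not_le)
  moreover have "{x. c < f x} \<in> sets lebesgue" using \<open>open {x. c < f x}\<close> by auto
  then have "{x. c < f x} \<in> null_sets lebesgue"
    using assms(2) AE_iff_null[of lebesgue "\<lambda>x. f x \<le> c"] by (simp add: not_le)
  ultimately show False by (simp add: negligible_iff_null_sets)
qed

lemma ballC_borel [measurable]: "ballC C x r \<in> sets borel"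
proof -
  define A where "A = {\<psi> \<in> C1. AE z in lebesgue. Gamma C \<psi> z \<le> 1}"
  have *: "dist_C C x y \<le> ereal s \<longleftrightarrow> (\<forall>\<psi>\<in>A. \<psi> x - \<psi> y \<le> s)" for y s
    unfolding dist_C_def A_def by (auto simp: SUP_le_iff)
  have "dist_C C x y < ereal r \<longleftrightarrow> (\<exists>n. dist_C C x y \<le> ereal (r - 1 / Suc n))" for y
  proof
    assume "dist_C C x y < ereal r"
    then obtain q where q: "dist_C C x y < ereal q" "ereal q < ereal r" using ereal_dense2 by blast
    then obtain n where "1 / real (Suc n) < r - q"
      using reals_Archimedean[of "r - q"] by (auto simp: inverse_eq_divide)
    then have "ereal q \<le> ereal (r - 1 / Suc n)" by simp
    with q(1) show "\<exists>n. dist_C C x y \<le> ereal (r - 1 / Suc n)" by (meson less_imp_le order_trans)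
  next
    assume "\<exists>n. dist_C C x y \<le> ereal (r - 1 / Suc n)"
    then obtain n where "dist_C C x y \<le> ereal (r - 1 / Suc n)" by blast
    also have "\<dots> < ereal r" by simp
    finally show "dist_C C x y < ereal r" .
  qed
  then have "ballC C x r = (\<Union>n. \<Inter>\<psi>\<in>A. {y. \<psi> x - \<psi> y \<le> r - 1 / Suc n})"
    unfolding ballC_def * by auto
  moreover have "closed (\<Inter>\<psi>\<in>A. {y. \<psi> x - \<psi> y \<le> r - 1 / Suc n})" for n
    by (intro closed_INT ballI closed_Collect_le continuous_intros C1_continuous_on) (auto simp: A_def)
  ultimately show ?thesis by (auto intro!: sets.countable_UN borel_closed)
qed

definition bump :: "real \<Rightarrow> real" where "bump s = (max 0 (1 - s))\<^sup>2"

lemma bump_deriv: "(bump has_real_derivative - 2 * max 0 (1 - s)) (at s)"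
proof -
  define p where "p u = (max 0 u)\<^sup>2" for u :: real
  have quad: "\<bar>p v - p u - 2 * max 0 u * (v - u)\<bar> \<le> (v - u)\<^sup>2" for u v
  proof -
    have "v\<^sup>2 \<le> (v - u)\<^sup>2" if "u \<le> 0" "0 \<le> v" using that by (intro power_mono) auto
    moreover have "\<bar>- u\<^sup>2 - 2 * u * (v - u)\<bar> \<le> (v - u)\<^sup>2" if "0 \<le> u" "v \<le> 0"
    proof -
      have "u * v \<le> 0" using that by (simp add: mult_nonneg_nonpos)
      moreover have "v\<^sup>2 \<ge> 0" "u\<^sup>2 \<ge> 0" by auto
      moreover have "(v - u)\<^sup>2 = v\<^sup>2 - 2 * (u * v) + u\<^sup>2" "- u\<^sup>2 - 2 * u * (v - u) = u\<^sup>2 - 2 * (u * v)"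
        by (simp_all add: power2_eq_square algebra_simps)
      ultimately show ?thesis by (simp only: abs_le_iff) linarith
    qed
    moreover have "v\<^sup>2 - u\<^sup>2 - 2 * u * (v - u) = (v - u)\<^sup>2"
      by (simp add: power2_eq_square algebra_simps)
    moreover have "0 \<le> (v - u)\<^sup>2" by simp
    ultimately show ?thesis
      unfolding p_def by (cases "0 \<le> u"; cases "0 \<le> v") (auto simp: max_absorb1 max_absorb2)
  qed
  have "(p has_real_derivative 2 * max 0 u) (at u)" for u
    unfolding has_field_derivative_iff
  proof (rule LIM_I)
    fix r :: real assume "0 < r"
    have "norm ((p y - p u) / (y - u) - 2 * max 0 u) < r" if "y \<noteq> u" "norm (y - u) < r" for y
    proof -
      have "(p y - p u) / (y - u) - 2 * max 0 u = (p y - p u - 2 * max 0 u * (y - u)) / (y - u)"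
        using that by (simp add: field_simps)
      then have "norm ((p y - p u) / (y - u) - 2 * max 0 u) \<le> (y - u)\<^sup>2 / \<bar>y - u\<bar>"
        using quad[of y u] by (simp add: divide_right_mono)
      also have "(y - u)\<^sup>2 = \<bar>y - u\<bar> * \<bar>y - u\<bar>" by (simp add: power2_eq_square)
      also have "\<bar>y - u\<bar> * \<bar>y - u\<bar> / \<bar>y - u\<bar> = \<bar>y - u\<bar>"
        using that(1) by (intro nonzero_mult_div_cancel_left) simp
      finally show ?thesis using that by simp
    qed
    then show "\<exists>s>0. \<forall>x. x \<noteq> u \<and> norm (x - u) < s \<longrightarrow> norm ((p x - p u) / (x - u) - 2 * max 0 u) < r"
      using \<open>0 < r\<close> by blast
  qed
  moreover have "((\<lambda>s. 1 - s) has_real_derivative - 1) (at s)"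
    by (auto intro!: derivative_eq_intros)
  ultimately have "((\<lambda>s. p (1 - s)) has_real_derivative 2 * max 0 (1 - s) * - 1) (at s)"
    by (rule DERIV_chain2)
  then show ?thesis by (simp add: bump_def[abs_def] p_def)
qed

lemma bump_bounds:
  "0 \<le> bump s" "1 \<le> s \<Longrightarrow> bump s = 0" "0 \<le> s \<Longrightarrow> bump s \<le> 1" "bump 0 = 1"
  by (auto simp: bump_def power_le_one)

lemma bump_slope:
  fixes s :: real
  shows "\<bar>s\<bar> * max 0 (1 - s\<^sup>2) \<le> 1"
proof (cases "\<bar>s\<bar> \<le> 1")
  case True
  moreover have "0 \<le> s\<^sup>2" by simp
  ultimately show ?thesis by (intro mult_le_one) (simp_all only: max.bounded_iff max.cobounded1, auto)
next
  case False
  then have "1 \<le> s\<^sup>2" using one_le_power[of "\<bar>s\<bar>" 2] by simp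
  then show ?thesis by simp
qed

locale grushin = weight d1 d1' F for d1 d1' F +
  fixes d2 d2' :: real
  assumes d2: "0 \<le> d2" "0 \<le> d2'"
begin

definition f1 :: "real \<Rightarrow> real" where "f1 t = pw \<bar>t\<bar> d1 d1'"
definition f2 :: "real \<Rightarrow> real" where "f2 t = pw \<bar>t\<bar> d2 d2'"
definition lo :: "real \<Rightarrow> real \<Rightarrow> real" where "lo t \<rho> = (SOME s. F s = F t - \<rho>)"
definition hi :: "real \<Rightarrow> real \<Rightarrow> real" where "hi t \<rho> = (SOME s. F s = F t + \<rho>)"
definition edge :: "real \<Rightarrow> real \<Rightarrow> real" where
  "edge t \<rho> = (if \<bar>lo t \<rho>\<bar> \<le> \<bar>hi t \<rho>\<bar> then hi t \<rho> else lo t \<rho>)"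
definition slab :: "'m::finite pt \<Rightarrow> real \<Rightarrow> 'm pt set" where
  "slab x \<rho> = {y. \<bar>F (x1 y) - F (x1 x)\<bar> \<le> \<rho> \<and> norm (x2 y - x2 x) \<le> \<rho> * f2 (edge (x1 x) \<rho>)}"
abbreviation \<Gamma> :: "('m::finite pt \<Rightarrow> real) \<Rightarrow> 'm pt \<Rightarrow> real" where
  "\<Gamma> \<equiv> Gamma (Cdelta d1 d1' d2 d2')"

lemma Gamma_eq: "\<Gamma> \<phi> x = (f1 (x1 x) * x1 (grad \<phi> x))\<^sup>2 + (f2 (x1 x) * norm (x2 (grad \<phi> x)))\<^sup>2"
  by (simp add: Gamma_Cdelta f1_def f2_def)

lemma F_lo: "F (lo t \<rho>) = F t - \<rho>" and F_hi: "F (hi t \<rho>) = F t + \<rho>"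
  unfolding lo_def hi_def using F_surj by (auto intro: someI_ex)

lemma F_le_iff: "F s \<le> F t \<longleftrightarrow> s \<le> t"
  using F_less_iff by (meson not_le)

lemma lo_less_hi: "0 < \<rho> \<Longrightarrow> lo t \<rho> < hi t \<rho>"
  using F_less_iff[of "lo t \<rho>" "hi t \<rho>"] by (simp add: F_lo F_hi)

lemma in_interval_iff: "\<bar>F s - F t\<bar> \<le> \<rho> \<longleftrightarrow> s \<in> {lo t \<rho>..hi t \<rho>}"
  using F_le_iff[of "lo t \<rho>" s] F_le_iff[of s "hi t \<rho>"] by (auto simp: F_lo F_hi)

lemma edge_bound:
  assumes "s \<in> {lo t \<rho>..hi t \<rho>}"
  shows "\<bar>s\<bar> \<le> \<bar>edge t \<rho>\<bar>"
  using assms by (auto simp: edge_def)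

lemma edge_nonzero: "0 < \<rho> \<Longrightarrow> edge t \<rho> \<noteq> 0"
  using lo_less_hi[of \<rho> t] by (auto simp: edge_def)

lemma F_edge: "0 \<le> \<rho> \<Longrightarrow> \<bar>F (edge t \<rho>) - F t\<bar> = \<rho>"
  by (auto simp: edge_def F_lo F_hi)

lemma f_pos: "t \<noteq> 0 \<Longrightarrow> 0 < f1 t" "t \<noteq> 0 \<Longrightarrow> 0 < f2 t"
  by (auto simp: f1_def f2_def intro: pw_pos)

lemma f2_nonneg: "0 \<le> f2 t" and f1_nonneg: "0 \<le> f1 t"
  by (simp_all add: f1_def f2_def pw_nonneg)

lemma f2_mono: "\<bar>s\<bar> \<le> \<bar>t\<bar> \<Longrightarrow> f2 s \<le> f2 t"
  unfolding f2_def using d2 by (intro pw_mono) auto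

lemma subunit_x1:
  assumes "\<psi> \<in> C1" "\<And>z. \<Gamma> \<psi> z \<le> b\<^sup>2" "0 \<le> b"
  shows "\<bar>\<psi> (emb (t, v)) - \<psi> (emb (s, v))\<bar> \<le> b * \<bar>F t - F s\<bar>"
proof -
  note D = C1_deriv_x1[OF assms(1), of v]
  have cont: "continuous_on UNIV (\<lambda>t. \<psi> (emb (t, v)))"
    using D by (intro DERIV_continuous_on)
  have slope: "\<bar>x1 (grad \<psi> (emb (t, v)))\<bar> \<le> b / f1 t" if "t \<noteq> 0" for t
  proof -
    have "(f1 t * x1 (grad \<psi> (emb (t, v))))\<^sup>2 \<le> b\<^sup>2"
      using assms(2)[of "emb (t, v)"] unfolding Gamma_eq x1_emb fst_conv
      by (rule order_trans[rotated]) simp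
    then have "\<bar>f1 t * x1 (grad \<psi> (emb (t, v)))\<bar> \<le> b"
      using assms(3) by (simp add: abs_le_square_iff[symmetric])
    then show ?thesis using f_pos(1)[OF that] by (simp add: abs_mult field_simps)
  qed
  have *: "\<bar>\<psi> (emb (t, v)) - \<psi> (emb (s, v))\<bar> \<le> b * (F t - F s)" if "s \<le> t" for s t
  proof -
    have sgn: "b * F s - \<sigma> * \<psi> (emb (s, v)) \<le> b * F t - \<sigma> * \<psi> (emb (t, v))" if "\<sigma> \<in> {-1, 1}" for \<sigma> :: real
    proof (rule increasing_except_zero[OF _ _ \<open>s \<le> t\<close>])
      show "continuous_on UNIV (\<lambda>t. b * F t - \<sigma> * \<psi> (emb (t, v)))"
        by (intro continuous_intros cont F_cont)
      fix t :: real assume t: "t \<noteq> 0"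
      have "((\<lambda>t. b * F t - \<sigma> * \<psi> (emb (t, v))) has_real_derivative
          b * (1 / pw \<bar>t\<bar> d1 d1') - \<sigma> * x1 (grad \<psi> (emb (t, v)))) (at t)"
        by (intro DERIV_diff DERIV_cmult F_deriv[OF t] D)
      moreover have "0 \<le> b * (1 / pw \<bar>t\<bar> d1 d1') - \<sigma> * x1 (grad \<psi> (emb (t, v)))"
        using slope[OF t] that by (auto simp: f1_def abs_le_iff)
      ultimately show "\<exists>y\<ge>0. ((\<lambda>t. b * F t - \<sigma> * \<psi> (emb (t, v))) has_real_derivative y) (at t)" by blast
    qed
    show ?thesis using sgn[of 1] sgn[of "-1"] by (simp add: abs_le_iff algebra_simps)
  qed
  show ?thesis
    using *[of s t] *[of t s] F_mono[of s t] F_mono[of t s] by (cases "s \<le> t") (auto simp: abs_minus_commute)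
qed

lemma subunit_x2:
  assumes "\<psi> \<in> C1" "\<And>z. \<Gamma> \<psi> z \<le> b\<^sup>2" "0 \<le> b" "t \<noteq> 0"
  shows "\<bar>\<psi> (emb (t, v)) - \<psi> (emb (t, v'))\<bar> \<le> b / f2 t * norm (v - v')"
proof -
  have "norm (\<psi> (emb (t, v)) - \<psi> (emb (t, v'))) \<le> b / f2 t * norm (v - v')"
  proof (rule differentiable_bound[of UNIV])
    fix w
    show "((\<lambda>v. \<psi> (emb (t, v))) has_derivative (\<lambda>h. x2 (grad \<psi> (emb (t, w))) \<bullet> h)) (at w within UNIV)"
      using C1_deriv_x2[OF assms(1)] by simp
    have "(f2 t * norm (x2 (grad \<psi> (emb (t, w)))))\<^sup>2 \<le> b\<^sup>2"
      using assms(2)[of "emb (t, w)"] unfolding Gamma_eq x1_emb fst_conv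
      by (rule order_trans[rotated]) simp
    then have "f2 t * norm (x2 (grad \<psi> (emb (t, w)))) \<le> b"
      using assms(3) by (rule power2_le_imp_le)
    then have n: "norm (x2 (grad \<psi> (emb (t, w)))) \<le> b / f2 t"
      using f_pos(2)[OF assms(4)] by (simp add: field_simps)
    show "onorm (\<lambda>h. x2 (grad \<psi> (emb (t, w))) \<bullet> h) \<le> b / f2 t"
    proof (rule onorm_le)
      fix h
      have "norm (x2 (grad \<psi> (emb (t, w))) \<bullet> h) \<le> norm (x2 (grad \<psi> (emb (t, w)))) * norm h"
        using Cauchy_Schwarz_ineq2 by simp
      also have "\<dots> \<le> b / f2 t * norm h" by (intro mult_right_mono n) simp
      finally show "norm (x2 (grad \<psi> (emb (t, w))) \<bullet> h) \<le> b / f2 t * norm h" .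
    qed
  qed auto
  then show ?thesis by simp
qed

lemma subunit_slab:
  assumes \<psi>: "\<psi> \<in> C1" "\<And>z. \<Gamma> \<psi> z \<le> b\<^sup>2" "0 \<le> b" and "0 < \<rho>" and y: "y \<in> slab x \<rho>"
  shows "\<psi> x - \<psi> y \<le> 4 * b * \<rho>"
proof -
  define z where "z = edge (x1 x) \<rho>"
  have z: "z \<noteq> 0" "\<bar>F z - F (x1 x)\<bar> = \<rho>"
    unfolding z_def using assms by (auto simp: edge_nonzero F_edge)
  have "\<bar>\<psi> (emb (x1 x, x2 x)) - \<psi> (emb (z, x2 x))\<bar> \<le> b * \<bar>F (x1 x) - F z\<bar>"
    by (rule subunit_x1[OF \<psi>])
  also have "\<dots> = b * \<rho>" using z(2) by (simp add: abs_minus_commute)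
  finally have 1: "\<psi> x - \<psi> (emb (z, x2 x)) \<le> b * \<rho>" by simp
  have "\<bar>\<psi> (emb (z, x2 x)) - \<psi> (emb (z, x2 y))\<bar> \<le> b / f2 z * norm (x2 x - x2 y)"
    by (rule subunit_x2[OF \<psi> z(1)])
  also have "\<dots> \<le> b / f2 z * (\<rho> * f2 z)"
    using y assms f2_nonneg by (intro mult_left_mono) (auto simp: slab_def z_def norm_minus_commute)
  also have "\<dots> = b * \<rho>" using f_pos(2)[OF z(1)] by simp
  finally have 2: "\<psi> (emb (z, x2 x)) - \<psi> (emb (z, x2 y)) \<le> b * \<rho>" by simp
  have "\<bar>\<psi> (emb (z, x2 y)) - \<psi> (emb (x1 y, x2 y))\<bar> \<le> b * \<bar>F z - F (x1 y)\<bar>"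
    by (rule subunit_x1[OF \<psi>])
  also have "\<dots> \<le> b * (2 * \<rho>)"
  proof (intro mult_left_mono)
    have "\<bar>F (x1 y) - F (x1 x)\<bar> \<le> \<rho>" using y by (simp add: slab_def)
    then show "\<bar>F z - F (x1 y)\<bar> \<le> 2 * \<rho>" using z(2) by linarith
  qed (rule \<psi>(3))
  finally have 3: "\<psi> (emb (z, x2 y)) - \<psi> y \<le> 2 * (b * \<rho>)" by simp
  show ?thesis using 1 2 3 by simp
qed

lemma ex_separating:
  fixes x y :: "'m::finite pt"
  assumes "0 < \<rho>" "0 < e" and y: "y \<notin> slab x \<rho>"
  shows "\<exists>\<psi>\<in>C1. (\<forall>z. \<Gamma> \<psi> z \<le> e\<^sup>2) \<and> \<psi> x - \<psi> y = e * \<rho> / 9"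
proof -
  define G where "G = f2 (edge (x1 x) \<rho>)"
  have G: "0 < G" unfolding G_def using assms by (intro f_pos edge_nonzero)
  obtain H h where H: "\<And>t. (H has_real_derivative h t) (at t)" and h_cont: "continuous_on UNIV h"
    and h: "\<And>t. 0 \<le> h t" "\<And>t. pw \<bar>t\<bar> d1 d1' * h t \<le> 1"
    and close: "\<And>s t. \<bar>(F t - F s) - (H t - H s)\<bar> \<le> \<rho> / 2"
    using ex_smooth_coordinate[of "\<rho> / 2"] assms(1) by auto
  define \<sigma> where "\<sigma> z = (H (x1 z) - H (x1 x)) / (\<rho> / 2)" for z :: "'m pt"
  define \<tau> where "\<tau> z = (1 / (\<rho> * G)) *\<^sub>R (x2 z - x2 x)" for z :: "'m pt"
  define q' where "q' s = - 2 * max 0 (1 - s)" for s :: real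
  define \<psi> where "\<psi> z = e * \<rho> / 9 * (bump ((\<sigma> z)\<^sup>2) * bump (\<tau> z \<bullet> \<tau> z))" for z
  define g1 where "g1 z = e * \<rho> / 9 * (q' ((\<sigma> z)\<^sup>2) * (2 * \<sigma> z * (h (x1 z) / (\<rho> / 2))) * bump (\<tau> z \<bullet> \<tau> z))" for z
  define g2 where "g2 z = (e * \<rho> / 9 * (bump ((\<sigma> z)\<^sup>2) * q' (\<tau> z \<bullet> \<tau> z) * 2 / (\<rho> * G))) *\<^sub>R \<tau> z" for z
  define g where "g z = emb (g1 z, g2 z)" for z
  have D\<sigma>: "(\<sigma> has_derivative (\<lambda>k. h (x1 z) / (\<rho> / 2) * x1 k)) (at z)" for z
  proof -
    have "(x1 has_derivative x1) (at z)"
      by (rule bounded_linear_imp_has_derivative) (simp add: x1_def[abs_def] bounded_linear_vec_nth)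
    from has_derivative_compose[OF this H[of "x1 z", unfolded has_field_derivative_def]]
    have "((\<lambda>z. H (x1 z)) has_derivative (\<lambda>k. h (x1 z) * x1 k)) (at z)" .
    then show ?thesis unfolding \<sigma>_def[abs_def] using assms(1)
      by (auto intro!: derivative_eq_intros)
  qed
  have D\<tau>: "(\<tau> has_derivative (\<lambda>k. (1 / (\<rho> * G)) *\<^sub>R x2 k)) (at z)" for z
  proof -
    have "(x2 has_derivative x2) (at z)"
      by (rule bounded_linear_imp_has_derivative[OF linear_conv_bounded_linear[THEN iffD1, OF linear_x2]])
    then show ?thesis unfolding \<tau>_def[abs_def] by (auto intro!: derivative_eq_intros)
  qed
  have Dbump: "(bump has_derivative (\<lambda>k. q' s * k)) (at s)" for s
    using bump_deriv[of s] unfolding has_field_derivative_def q'_def .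
  have D\<psi>: "(\<psi> has_derivative (\<lambda>k. g z \<bullet> k)) (at z)" for z
  proof -
    have "((\<lambda>z. (\<sigma> z)\<^sup>2) has_derivative (\<lambda>k. 2 * \<sigma> z * (h (x1 z) / (\<rho> / 2) * x1 k))) (at z)"
      by (auto intro!: derivative_eq_intros D\<sigma>)
    note 1 = has_derivative_compose[OF this Dbump]
    have "((\<lambda>z. \<tau> z \<bullet> \<tau> z) has_derivative (\<lambda>k. 2 * ((1 / (\<rho> * G)) * (\<tau> z \<bullet> x2 k)))) (at z)"
      by (auto intro!: derivative_eq_intros D\<tau> simp: inner_commute)
    note 2 = has_derivative_compose[OF this Dbump]
    show ?thesis unfolding \<psi>_def[abs_def]
      by (rule has_derivative_eq_rhs, rule has_derivative_mult_right, rule has_derivative_mult[OF 1 2])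
         (auto simp: fun_eq_iff g_def g1_def g2_def inner_pt algebra_simps)
  qed
  have g_cont: "continuous_on UNIV g"
  proof -
    have c\<sigma>: "continuous_on UNIV \<sigma>" and c\<tau>: "continuous_on UNIV \<tau>"
      by (auto intro!: continuous_at_imp_continuous_on has_derivative_continuous[OF D\<sigma>] has_derivative_continuous[OF D\<tau>])
    have cb: "continuous_on UNIV bump"
      by (auto intro!: continuous_at_imp_continuous_on has_derivative_continuous[OF Dbump])
    have cq: "continuous_on UNIV q'" unfolding q'_def by (intro continuous_intros)
    have "continuous_on UNIV g1" "continuous_on UNIV g2"
      unfolding g1_def g2_def using assms(1) G
      by (auto intro!: continuous_intros c\<sigma> c\<tau> continuous_on_compose2[OF cb] continuous_on_compose2[OF cq]
          continuous_on_compose2[OF h_cont] continuous_on_x1)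
    then show ?thesis unfolding g_def
      by (intro continuous_on_compose2[OF continuous_on_emb[of UNIV]] continuous_on_Pair) auto
  qed
  have C1: "\<psi> \<in> C1" using C1_I[OF D\<psi> g_cont] .
  have grad: "grad \<psi> z = g z" for z using grad_eqI[OF D\<psi>] .
  have near: "f2 (x1 z) \<le> G" if "bump ((\<sigma> z)\<^sup>2) \<noteq> 0" for z
  proof -
    have "(\<sigma> z)\<^sup>2 < 1" using that bump_bounds(2)[of "(\<sigma> z)\<^sup>2"] by (meson not_le)
    then have "\<bar>\<sigma> z\<bar> < 1" by (simp add: abs_square_less_1)
    then have "\<bar>H (x1 z) - H (x1 x)\<bar> < \<rho> / 2" using assms(1) by (auto simp: \<sigma>_def abs_less_iff abs_if field_simps)
    then have "\<bar>F (x1 z) - F (x1 x)\<bar> \<le> \<rho>" using close[of "x1 z" "x1 x"] by linarith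
    then show ?thesis unfolding in_interval_iff G_def by (intro f2_mono edge_bound)
  qed
  have bb: "0 \<le> bump u" "0 \<le> u \<Longrightarrow> bump u \<le> 1" for u using bump_bounds by auto
  have "\<Gamma> \<psi> z \<le> e\<^sup>2" for z
  proof -
    have "\<bar>f1 (x1 z) * g1 z\<bar> = (8 * e / 9) * (f1 (x1 z) * h (x1 z)) * (\<bar>\<sigma> z\<bar> * max 0 (1 - (\<sigma> z)\<^sup>2)) * bump (\<tau> z \<bullet> \<tau> z)"
      using assms(1,2) h(1)[of "x1 z"] bb(1) f1_nonneg by (simp add: g1_def q'_def abs_mult)
    also have "\<dots> \<le> (8 * e / 9) * 1 * 1 * 1"
      using assms(2) h(2)[of "x1 z"] h(1)[of "x1 z"] bump_slope[of "\<sigma> z"] bb f1_nonneg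
      by (intro mult_mono) (auto simp: f1_def)
    finally have 1: "(f1 (x1 z) * g1 z)\<^sup>2 \<le> (8 * e / 9)\<^sup>2"
      using power_mono[of "\<bar>f1 (x1 z) * g1 z\<bar>" "8 * e / 9" 2] by simp
    have "f2 (x1 z) * norm (g2 z) = (4 * e / 9) * (f2 (x1 z) * bump ((\<sigma> z)\<^sup>2) / G) * (norm (\<tau> z) * max 0 (1 - (norm (\<tau> z))\<^sup>2))"
      using assms(1,2) G bb(1) by (simp add: g2_def q'_def abs_mult power2_norm_eq_inner)
    also have "\<dots> \<le> (4 * e / 9) * 1 * 1"
    proof (intro mult_mono)
      show "f2 (x1 z) * bump ((\<sigma> z)\<^sup>2) / G \<le> 1"
      proof (cases "bump ((\<sigma> z)\<^sup>2) = 0")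
        case False
        have "f2 (x1 z) * bump ((\<sigma> z)\<^sup>2) \<le> G * 1"
          using near[OF False] bb G by (intro mult_mono) auto
        then show ?thesis using G by simp
      qed simp
      show "norm (\<tau> z) * max 0 (1 - (norm (\<tau> z))\<^sup>2) \<le> 1" using bump_slope[of "norm (\<tau> z)"] by simp
    qed (use assms(2) G bb f2_nonneg in auto)
    finally have 2: "(f2 (x1 z) * norm (g2 z))\<^sup>2 \<le> (4 * e / 9)\<^sup>2"
      using f2_nonneg by (intro power_mono) auto
    have "\<Gamma> \<psi> z = (f1 (x1 z) * g1 z)\<^sup>2 + (f2 (x1 z) * norm (g2 z))\<^sup>2"
      by (simp add: Gamma_eq grad g_def)
    also have "\<dots> \<le> (8 * e / 9)\<^sup>2 + (4 * e / 9)\<^sup>2" using 1 2 by simp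
    also have "\<dots> \<le> e\<^sup>2" by (simp add: power2_eq_square)
    finally show ?thesis .
  qed
  moreover have "\<psi> x = e * \<rho> / 9" by (simp add: \<psi>_def \<sigma>_def \<tau>_def bump_bounds)
  moreover have "\<psi> y = 0"
  proof (cases "\<bar>F (x1 y) - F (x1 x)\<bar> \<le> \<rho>")
    case True
    then have "\<rho> * G < norm (x2 y - x2 x)" using y by (auto simp: slab_def G_def)
    then have "1 \<le> norm (\<tau> y)" using assms(1) G by (simp add: \<tau>_def)
    then have "1 \<le> (norm (\<tau> y))\<^sup>2" by simp
    then show ?thesis by (simp add: \<psi>_def bump_bounds(2) power2_norm_eq_inner)
  next
    case False
    then have "\<rho> / 2 \<le> \<bar>H (x1 y) - H (x1 x)\<bar>" using close[of "x1 y" "x1 x"] by linarith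
    then have "1 \<le> \<bar>\<sigma> y\<bar>" using assms(1) by (auto simp: \<sigma>_def abs_if field_simps split: if_splits)
    then have "1 \<le> (\<sigma> y)\<^sup>2" using one_le_power[of "\<bar>\<sigma> y\<bar>" 2] by simp
    then show ?thesis by (simp add: \<psi>_def bump_bounds(2))
  qed
  ultimately show ?thesis using C1 by (intro bexI[of _ \<psi>]) auto
qed

end

section \<open>The weighted Poincare inequality\<close>

context grushin
begin

lemma measurable_f [measurable]: "f1 \<in> borel_measurable borel" "f2 \<in> borel_measurable borel"
  unfolding f1_def[abs_def] f2_def[abs_def] by measurable

lemma measurable_F [measurable]: "F \<in> borel_measurable borel"
  using F_cont by (rule borel_measurable_continuous_onI)

lemma slab_borel [measurable]: "slab x \<rho> \<in> sets borel"
  unfolding slab_def by measurable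

lemma indicator_slab:
  "indicator (slab x \<rho>) (emb (t, v)) =
    (indicator {lo (x1 x) \<rho>..hi (x1 x) \<rho>} t * indicator (cball (x2 x) (\<rho> * f2 (edge (x1 x) \<rho>))) v :: ennreal)"
  by (auto simp: indicator_def slab_def in_interval_iff dist_norm norm_minus_commute)

lemma bounded_slab: "bounded (slab x \<rho>)"
proof -
  let ?K = "{lo (x1 x) \<rho>..hi (x1 x) \<rho>} \<times> cball (x2 x) (\<rho> * f2 (edge (x1 x) \<rho>))"
  have "y \<in> emb ` ?K" if "y \<in> slab x \<rho>" for y
    using that emb_x1_x2[of y] by (intro image_eqI[of y emb "(x1 y, x2 y)"])
      (auto simp: slab_def in_interval_iff dist_norm norm_minus_commute)
  moreover have "compact (emb ` ?K)"
    by (intro compact_continuous_image continuous_on_emb compact_Times) auto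
  ultimately show ?thesis by (meson bounded_subset compact_imp_bounded subsetI)
qed

lemma ex_thick_part:
  assumes "0 < \<rho>"
  shows "\<exists>p q. {p..q} \<subseteq> {lo t \<rho>..hi t \<rho>} \<and> hi t \<rho> - lo t \<rho> = 4 * (q - p) \<and> p < q \<and>
    (\<forall>z\<in>{p..q}. f2 (edge t \<rho>) \<le> 2 powr (d2 + d2') * f2 z)"
proof -
  let ?a = "lo t \<rho>" and ?b = "hi t \<rho>"
  have ab: "?a < ?b" using assms by (rule lo_less_hi)
  define p where "p = (if \<bar>?a\<bar> \<le> \<bar>?b\<bar> then (?a + 3 * ?b) / 4 else ?a)"
  define q where "q = p + (?b - ?a) / 4"
  have "f2 (edge t \<rho>) \<le> 2 powr (d2 + d2') * f2 z" if "z \<in> {p..q}" for z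
  proof -
    have "\<bar>edge t \<rho>\<bar> / 2 \<le> \<bar>z\<bar>" "\<bar>z\<bar> \<le> \<bar>edge t \<rho>\<bar>"
      using that ab by (auto simp: edge_def p_def q_def abs_if field_simps split: if_splits)
    then show ?thesis
      unfolding f2_def using edge_nonzero[OF assms, of t] d2 by (intro pw_doubling) auto
  qed
  moreover have "{p..q} \<subseteq> {?a..?b}" using ab by (auto simp: p_def q_def field_simps)
  ultimately show ?thesis using ab by (intro exI[of _ p] exI[of _ q]) (simp add: q_def)
qed

lemma slab_Poincare:
  fixes \<phi> :: "'m::finite pt \<Rightarrow> real"
  assumes \<phi>: "\<phi> \<in> C1" and \<rho>: "0 < \<rho>" and K: "0 \<le> K"
    and RH: "ennreal (hi (x1 x) \<rho> - lo (x1 x) \<rho>) *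
      (\<integral>\<^sup>+ t\<in>{lo (x1 x) \<rho>..hi (x1 x) \<rho>}. ennreal ((1 / f1 t)\<^sup>2) \<partial>lborel) \<le> ennreal (K * \<rho>\<^sup>2)"
  shows "\<exists>c. (\<integral>\<^sup>+ y\<in>slab x \<rho>. ennreal ((\<phi> y - c)\<^sup>2) \<partial>lborel) \<le>
    ennreal ((2 * K + 32 * 2 ^ CARD('m) * (2 powr (d2 + d2'))\<^sup>2) * \<rho>\<^sup>2) * (\<integral>\<^sup>+ y\<in>slab x \<rho>. ennreal (\<Gamma> \<phi> y) \<partial>lborel)"
proof -
  define I where "I = {lo (x1 x) \<rho>..hi (x1 x) \<rho>}"
  define G where "G = f2 (edge (x1 x) \<rho>)"
  define J where "J = cball (x2 x) (\<rho> * G)"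
  define E where "E = (\<integral>\<^sup>+ y\<in>slab x \<rho>. ennreal (\<Gamma> \<phi> y) \<partial>lborel)"
  define W where "W = (\<integral>\<^sup>+ t\<in>I. ennreal ((1 / f1 t)\<^sup>2) \<partial>lborel)"
  define D where "D = 2 powr (d2 + d2')"
  define A1 where "A1 t v = ennreal ((f1 t * x1 (grad \<phi> (emb (t, v))))\<^sup>2)" for t v
  define A2 where "A2 t v = ennreal ((f2 t * norm (x2 (grad \<phi> (emb (t, v)))))\<^sup>2)" for t v
  define iI where "iI t = (indicator I t :: ennreal)" for t
  define iJ where "iJ v = (indicator J v :: ennreal)" for v
  have G: "0 < G" unfolding G_def using \<rho> by (intro f_pos edge_nonzero)
  have [measurable]: "I \<in> sets borel" "J \<in> sets borel" by (auto simp: I_def J_def)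
  have [measurable]: "grad \<phi> \<in> borel_measurable borel"
    by (rule borel_measurable_continuous_onI[OF continuous_on_grad[OF \<phi>]])
  have [measurable]: "\<phi> \<in> borel_measurable borel"
    by (rule borel_measurable_continuous_onI[OF C1_continuous_on[OF \<phi>]])
  have [measurable]: "iI \<in> borel_measurable borel" "iJ \<in> borel_measurable borel"
    unfolding iI_def iJ_def by measurable
  have [measurable]: "case_prod A1 \<in> borel_measurable (borel \<Otimes>\<^sub>M borel)" "case_prod A2 \<in> borel_measurable (borel \<Otimes>\<^sub>M borel)"
    unfolding A1_def A2_def by measurable
  have [measurable]: "\<Gamma> \<phi> \<in> borel_measurable borel"
    unfolding Gamma_eq[abs_def] by measurable
  have ind: "indicator (slab x \<rho>) (emb (t, v)) = iI t * iJ v" for t v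
    by (simp add: indicator_slab iI_def iJ_def I_def J_def G_def)
  have E: "E = (\<integral>\<^sup>+ t. \<integral>\<^sup>+ v. (A1 t v + A2 t v) * (iI t * iJ v) \<partial>lborel \<partial>lborel)"
    unfolding E_def by (subst nn_integral_pt) (simp_all add: ind Gamma_eq A1_def A2_def ennreal_plus)
  have E1: "(\<integral>\<^sup>+ t. \<integral>\<^sup>+ v. A1 t v * (iI t * iJ v) \<partial>lborel \<partial>lborel) \<le> E"
    unfolding E by (intro nn_integral_mono mult_right_mono) auto
  have E2: "(\<integral>\<^sup>+ t. \<integral>\<^sup>+ v. A2 t v * (iI t * iJ v) \<partial>lborel \<partial>lborel) \<le> E"
    unfolding E by (intro nn_integral_mono mult_right_mono) auto
  obtain p q where pq: "{p..q} \<subseteq> I" "hi (x1 x) \<rho> - lo (x1 x) \<rho> = 4 * (q - p)" "p < q"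
      "\<And>z. z \<in> {p..q} \<Longrightarrow> G \<le> D * f2 z"
    using ex_thick_part[OF \<rho>, of "x1 x"] unfolding I_def G_def D_def by blast
  have "\<exists>z\<in>{p..q}. emeasure lborel {p..q} * (\<integral>\<^sup>+ v. A2 z v * iJ v \<partial>lborel) \<le>
      (\<integral>\<^sup>+ t\<in>{p..q}. (\<integral>\<^sup>+ v. A2 t v * iJ v \<partial>lborel) \<partial>lborel)"
    using pq(3) by (intro ex_le_average) simp_all
  then obtain z where z: "z \<in> {p..q}" and zle: "ennreal (q - p) * (\<integral>\<^sup>+ v. A2 z v * iJ v \<partial>lborel) \<le>
      (\<integral>\<^sup>+ t\<in>{p..q}. (\<integral>\<^sup>+ v. A2 t v * iJ v \<partial>lborel) \<partial>lborel)"
    using pq(3) by auto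
  note zle
  also have "(\<integral>\<^sup>+ t\<in>{p..q}. (\<integral>\<^sup>+ v. A2 t v * iJ v \<partial>lborel) \<partial>lborel) \<le>
      (\<integral>\<^sup>+ t. (\<integral>\<^sup>+ v. A2 t v * iJ v \<partial>lborel) * iI t \<partial>lborel)"
    using pq(1) by (intro nn_integral_mono mult_left_mono) (auto simp: indicator_def iI_def)
  also have "\<dots> = (\<integral>\<^sup>+ t. \<integral>\<^sup>+ v. A2 t v * (iI t * iJ v) \<partial>lborel \<partial>lborel)"
    by (intro nn_integral_cong) (auto simp: iI_def indicator_def)
  also note E2
  finally have zE: "ennreal (q - p) * (\<integral>\<^sup>+ v. A2 z v * iJ v \<partial>lborel) \<le> E" .
  have zI: "z \<in> I" using z pq(1) by blast

  define f where "f v = \<phi> (emb (z, v))" for v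
  define N where "N = (\<integral>\<^sup>+ v. ennreal ((norm (x2 (grad \<phi> (emb (z, v)))))\<^sup>2) * iJ v \<partial>lborel)"
  have J: "emeasure lborel J \<noteq> 0" "emeasure lborel J \<noteq> \<infinity>"
  proof -
    have "measure lborel J > 0" unfolding J_def using \<rho> G
      by (metis content_cball_pos mult_pos_pos)
    then show "emeasure lborel J \<noteq> 0" by (auto simp: measure_def)
    show "emeasure lborel J \<noteq> \<infinity>"
      using emeasure_bounded_finite[of J] by (auto simp: J_def)
  qed
  have [measurable]: "f \<in> borel_measurable borel" unfolding f_def by measurable
  have P: "(\<integral>\<^sup>+ v\<in>J. (\<integral>\<^sup>+ w\<in>J. ennreal ((f w - f v)\<^sup>2) \<partial>lborel) \<partial>lborel) \<le>
    ennreal ((2 * (\<rho> * G))\<^sup>2) * 2 ^ DIM(real ^ 'm) * emeasure lborel J * N"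
    unfolding N_def iJ_def
  proof (rule convex_Poincare)
    show "(f has_derivative (\<lambda>h. x2 (grad \<phi> (emb (z, v))) \<bullet> h)) (at v)" for v
      unfolding f_def by (rule C1_deriv_x2[OF \<phi>])
    show "continuous_on UNIV (\<lambda>v. x2 (grad \<phi> (emb (z, v))))"
      by (intro continuous_on_compose2[OF continuous_on_x2[of UNIV]]
          continuous_on_compose2[OF continuous_on_grad[OF \<phi>, of UNIV]]
          continuous_on_compose2[OF continuous_on_emb[of UNIV]] continuous_intros) auto
    show "norm (w - v) \<le> 2 * (\<rho> * G)" if "v \<in> J" "w \<in> J" for v w
    proof -
      have "dist v (x2 x) \<le> \<rho> * G" "dist w (x2 x) \<le> \<rho> * G" using that by (auto simp: J_def dist_commute)
      then have "dist w v \<le> 2 * (\<rho> * G)" using dist_triangle2[of w v "x2 x"] by linarith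
      then show ?thesis by (simp add: dist_norm)
    qed
  qed (use \<rho> G in \<open>auto simp: J_def\<close>)
  have "\<exists>v\<in>J. emeasure lborel J * (\<integral>\<^sup>+ w\<in>J. ennreal ((f w - f v)\<^sup>2) \<partial>lborel) \<le>
    (\<integral>\<^sup>+ v\<in>J. (\<integral>\<^sup>+ w\<in>J. ennreal ((f w - f v)\<^sup>2) \<partial>lborel) \<partial>lborel)"
    using J by (intro ex_le_average) simp_all
  then obtain v0 where "emeasure lborel J * (\<integral>\<^sup>+ w\<in>J. ennreal ((f w - f v0)\<^sup>2) \<partial>lborel) \<le>
    ennreal ((2 * (\<rho> * G))\<^sup>2) * 2 ^ DIM(real ^ 'm) * emeasure lborel J * N"
    using P by (meson order_trans)
  then have "emeasure lborel J * (\<integral>\<^sup>+ w\<in>J. ennreal ((f w - f v0)\<^sup>2) \<partial>lborel) \<le>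
    emeasure lborel J * (ennreal ((2 * (\<rho> * G))\<^sup>2) * 2 ^ CARD('m) * N)"
    by (simp add: mult_ac)
  then have B: "(\<integral>\<^sup>+ w\<in>J. ennreal ((f w - f v0)\<^sup>2) \<partial>lborel) \<le> ennreal ((2 * (\<rho> * G))\<^sup>2) * 2 ^ CARD('m) * N"
    using J by (subst (asm) ennreal_mult_le_mult_iff) auto
  define c where "c = f v0"
  define X where "X = 4 * \<rho>\<^sup>2 * 2 ^ CARD('m) * D\<^sup>2"
  have X: "0 \<le> X" by (simp add: X_def)
  have "ennreal ((2 * (\<rho> * G))\<^sup>2) * 2 ^ CARD('m) * N =
    (\<integral>\<^sup>+ v. ennreal ((2 * (\<rho> * G))\<^sup>2 * 2 ^ CARD('m)) * (ennreal ((norm (x2 (grad \<phi> (emb (z, v)))))\<^sup>2) * iJ v) \<partial>lborel)"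
    unfolding N_def by (subst nn_integral_cmult) (simp_all add: ennreal_mult flip: ennreal_power)
  also have "\<dots> \<le> (\<integral>\<^sup>+ v. ennreal X * (A2 z v * iJ v) \<partial>lborel)"
  proof (rule nn_integral_mono)
    fix v
    have "(2 * (\<rho> * G))\<^sup>2 * 2 ^ CARD('m) * (norm (x2 (grad \<phi> (emb (z, v)))))\<^sup>2
      = (4 * \<rho>\<^sup>2 * 2 ^ CARD('m)) * (G * norm (x2 (grad \<phi> (emb (z, v)))))\<^sup>2"
      by (simp add: power_mult_distrib mult_ac)
    also have "\<dots> \<le> (4 * \<rho>\<^sup>2 * 2 ^ CARD('m)) * (D * f2 z * norm (x2 (grad \<phi> (emb (z, v)))))\<^sup>2"
      using pq(4)[OF z] G by (intro mult_left_mono power_mono mult_right_mono) auto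
    also have "\<dots> = X * (f2 z * norm (x2 (grad \<phi> (emb (z, v)))))\<^sup>2"
      by (simp add: X_def power_mult_distrib mult_ac)
    finally have "ennreal ((2 * (\<rho> * G))\<^sup>2 * 2 ^ CARD('m)) * ennreal ((norm (x2 (grad \<phi> (emb (z, v)))))\<^sup>2) \<le> ennreal X * A2 z v"
      unfolding A2_def using X by (simp add: ennreal_leI flip: ennreal_mult)
    then show "ennreal ((2 * (\<rho> * G))\<^sup>2 * 2 ^ CARD('m)) * (ennreal ((norm (x2 (grad \<phi> (emb (z, v)))))\<^sup>2) * iJ v) \<le> ennreal X * (A2 z v * iJ v)"
      unfolding mult.assoc[symmetric] by (rule mult_right_mono) simp
  qed
  also have "\<dots> = ennreal X * (\<integral>\<^sup>+ v. A2 z v * iJ v \<partial>lborel)"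
    by (intro nn_integral_cmult) measurable
  finally have B': "(\<integral>\<^sup>+ v. ennreal ((f v - c)\<^sup>2) * iJ v \<partial>lborel) \<le> ennreal X * (\<integral>\<^sup>+ v. A2 z v * iJ v \<partial>lborel)"
    using B unfolding c_def iJ_def by (rule order_trans[rotated])

  have len: "(\<integral>\<^sup>+ t. iI t \<partial>lborel) = ennreal (4 * (q - p))"
    using lo_less_hi[OF \<rho>, of "x1 x"] pq(2) by (simp add: iI_def I_def)
  have step: "ennreal ((\<phi> (emb (t, v)) - c)\<^sup>2) * (iI t * iJ v) \<le>
      2 * (W * ((\<integral>\<^sup>+ s. A1 s v * iI s \<partial>lborel) * iJ v)) * iI t + 2 * (ennreal ((f v - c)\<^sup>2) * iJ v) * iI t" for t v
  proof (cases "t \<in> I")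
    case True
    have sq: "(a + b)\<^sup>2 \<le> 2 * a\<^sup>2 + 2 * b\<^sup>2" for a b :: real
      using zero_le_power2[of "a - b"] by (simp add: power2_eq_square algebra_simps)
    have "(\<phi> (emb (t, v)) - c)\<^sup>2 \<le> 2 * (\<phi> (emb (t, v)) - \<phi> (emb (z, v)))\<^sup>2 + 2 * (f v - c)\<^sup>2"
      using sq[of "\<phi> (emb (t, v)) - \<phi> (emb (z, v))" "f v - c"] by (simp add: f_def)
    moreover have "ennreal (2 * u + 2 * w) = 2 * ennreal u + 2 * ennreal w" if "0 \<le> u" "0 \<le> w" for u w
      using that by (simp add: ennreal_mult)
    ultimately have "ennreal ((\<phi> (emb (t, v)) - c)\<^sup>2) \<le>
      2 * ennreal ((\<phi> (emb (t, v)) - \<phi> (emb (z, v)))\<^sup>2) + 2 * ennreal ((f v - c)\<^sup>2)"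
      by (metis ennreal_leI zero_le_power2)
    also have "ennreal ((\<phi> (emb (t, v)) - \<phi> (emb (z, v)))\<^sup>2) \<le>
      (\<integral>\<^sup>+ s\<in>I. ennreal ((1 / f1 s)\<^sup>2) \<partial>lborel) * (\<integral>\<^sup>+ s\<in>I. ennreal ((f1 s * x1 (grad \<phi> (emb (s, v))))\<^sup>2) \<partial>lborel)"
      unfolding I_def
    proof (rule weighted_increment[where h = "\<lambda>t. \<phi> (emb (t, v))"])
      show "((\<lambda>t. \<phi> (emb (t, v))) has_real_derivative x1 (grad \<phi> (emb (t, v)))) (at t)" for t
        by (rule C1_deriv_x1[OF \<phi>])
      show "continuous_on UNIV (\<lambda>t. x1 (grad \<phi> (emb (t, v))))"
        by (intro continuous_on_compose2[OF continuous_on_x1[of UNIV]]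
          continuous_on_compose2[OF continuous_on_grad[OF \<phi>, of UNIV]]
          continuous_on_compose2[OF continuous_on_emb[of UNIV]] continuous_intros) auto
    qed (use True zI in \<open>auto simp: I_def intro: f_pos\<close>)
    also have "\<dots> = W * (\<integral>\<^sup>+ s. A1 s v * iI s \<partial>lborel)" by (simp add: W_def A1_def iI_def)
    finally have "ennreal ((\<phi> (emb (t, v)) - c)\<^sup>2) \<le> 2 * (W * (\<integral>\<^sup>+ s. A1 s v * iI s \<partial>lborel)) + 2 * ennreal ((f v - c)\<^sup>2)"
      by (simp add: add_right_mono mult_left_mono)
    then have "ennreal ((\<phi> (emb (t, v)) - c)\<^sup>2) * (iI t * iJ v) \<le>
      (2 * (W * (\<integral>\<^sup>+ s. A1 s v * iI s \<partial>lborel)) + 2 * ennreal ((f v - c)\<^sup>2)) * (iI t * iJ v)"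
      by (rule mult_right_mono) simp
    then show ?thesis by (simp add: distrib_left distrib_right mult_ac)
  qed (simp add: iI_def)
  have "(\<integral>\<^sup>+ y\<in>slab x \<rho>. ennreal ((\<phi> y - c)\<^sup>2) \<partial>lborel) =
      (\<integral>\<^sup>+ t. \<integral>\<^sup>+ v. ennreal ((\<phi> (emb (t, v)) - c)\<^sup>2) * (iI t * iJ v) \<partial>lborel \<partial>lborel)"
    by (subst nn_integral_pt) (simp_all add: ind)
  also have "\<dots> \<le> (\<integral>\<^sup>+ t. \<integral>\<^sup>+ v. 2 * (W * ((\<integral>\<^sup>+ s. A1 s v * iI s \<partial>lborel) * iJ v)) * iI t + 2 * (ennreal ((f v - c)\<^sup>2) * iJ v) * iI t \<partial>lborel \<partial>lborel)"
    by (intro nn_integral_mono step)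
  also have "\<dots> = (\<integral>\<^sup>+ t. (2 * (W * (\<integral>\<^sup>+ v. (\<integral>\<^sup>+ s. A1 s v * iI s \<partial>lborel) * iJ v \<partial>lborel)) +
      2 * (\<integral>\<^sup>+ v. ennreal ((f v - c)\<^sup>2) * iJ v \<partial>lborel)) * iI t \<partial>lborel)"
    by (simp add: nn_integral_add nn_integral_cmult nn_integral_multc distrib_right)
  also have "\<dots> = (2 * (W * (\<integral>\<^sup>+ v. (\<integral>\<^sup>+ s. A1 s v * iI s \<partial>lborel) * iJ v \<partial>lborel)) +
      2 * (\<integral>\<^sup>+ v. ennreal ((f v - c)\<^sup>2) * iJ v \<partial>lborel)) * ennreal (4 * (q - p))"
    by (simp add: nn_integral_cmult len)
  also have "(\<integral>\<^sup>+ v. (\<integral>\<^sup>+ s. A1 s v * iI s \<partial>lborel) * iJ v \<partial>lborel) = (\<integral>\<^sup>+ v. \<integral>\<^sup>+ s. A1 s v * (iI s * iJ v) \<partial>lborel \<partial>lborel)"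
    by (simp add: nn_integral_multc[symmetric] mult.assoc)
  also have "\<dots> = (\<integral>\<^sup>+ s. \<integral>\<^sup>+ v. A1 s v * (iI s * iJ v) \<partial>lborel \<partial>lborel)"
    by (rule lborel_pair.Fubini') measurable
  also have "(2 * (W * (\<integral>\<^sup>+ s. \<integral>\<^sup>+ v. A1 s v * (iI s * iJ v) \<partial>lborel \<partial>lborel)) +
      2 * (\<integral>\<^sup>+ v. ennreal ((f v - c)\<^sup>2) * iJ v \<partial>lborel)) * ennreal (4 * (q - p))
    \<le> (2 * (W * E) + 2 * (ennreal X * (\<integral>\<^sup>+ v. A2 z v * iJ v \<partial>lborel))) * ennreal (4 * (q - p))"
    by (intro mult_right_mono add_mono mult_left_mono E1 B') auto
  also have "\<dots> = 2 * (ennreal (4 * (q - p)) * W) * E + 8 * ennreal X * (ennreal (q - p) * (\<integral>\<^sup>+ v. A2 z v * iJ v \<partial>lborel))"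
  proof -
    have 4: "ennreal (4 * (q - p)) = 4 * ennreal (q - p)"
      by (subst ennreal_mult) (use pq(3) in simp_all)
    have 8: "(8::ennreal) = 2 * 4" by simp
    show ?thesis unfolding 4 8 by (simp only: distrib_left distrib_right mult_ac)
  qed
  also have "\<dots> \<le> 2 * ennreal (K * \<rho>\<^sup>2) * E + 8 * ennreal X * E"
    using RH unfolding pq(2) W_def[symmetric] I_def[symmetric]
    by (intro add_mono mult_left_mono mult_right_mono zE) auto
  also have "\<dots> = ennreal (2 * (K * \<rho>\<^sup>2) + 8 * X) * E"
    using K X by (simp add: ennreal_mult ennreal_plus distrib_right)
  also have "2 * (K * \<rho>\<^sup>2) + 8 * X = (2 * K + 32 * 2 ^ CARD('m) * D\<^sup>2) * \<rho>\<^sup>2"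
    by (simp add: X_def algebra_simps)
  finally show ?thesis unfolding E_def D_def by blast
qed

end

lemma Gamma_bounds:
  assumes "mat_le (a *\<^sub>R A x) (C x)" "mat_le (C x) (a' *\<^sub>R A x)"
  shows "a * Gamma A \<phi> x \<le> Gamma C \<phi> x" "Gamma C \<phi> x \<le> a' * Gamma A \<phi> x"
  using assms unfolding mat_le_def Gamma_def
  by (auto simp: scaleR_matrix_vector_assoc[symmetric] dest!: spec[of _ "grad \<phi> x"])

theorem theorem5p1:
  fixes C :: "'m::finite pt \<Rightarrow> 'm mat"
    and d1 d1' d2 d2' a a' :: real
  assumes "0 \<le> d1" "d1 < 1/2" "1/2 \<le> d1'" "d1' < 1"
    and "0 \<le> d2" "0 \<le> d2'"
    and "0 < a" "0 < a'"
    and "\<And>x. transpose (C x) = C x"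
    and "\<And>i j. (\<lambda>x. C x $ i $ j) \<in> borel_measurable lebesgue"
    and "AE x in lebesgue. mat_le (a *\<^sub>R Cdelta d1 d1' d2 d2' x) (C x)
                         \<and> mat_le (C x) (a' *\<^sub>R Cdelta d1 d1' d2 d2' x)"
  shows "\<exists>\<kappa>. 0 < \<kappa> \<and> \<kappa> \<le> 1 \<and>
     (\<forall>R>0. \<exists>lam>0. \<forall>x r \<phi>. 0 < r \<longrightarrow> r \<le> R \<longrightarrow> \<phi> \<in> C1 \<longrightarrow>
        (\<integral>\<^sup>+ y\<in>ballC C x r. ennreal (Gamma C \<phi> y) \<partial>lebesgue)
        \<ge> ennreal (lam / r\<^sup>2) *
          (\<integral>\<^sup>+ y\<in>ballC C x (\<kappa>*r).
              ennreal ((\<phi> y - avg \<phi> (ballC C x (\<kappa>*r)))\<^sup>2) \<partial>lebesgue))"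
proof -
  obtain F where F: "continuous_on UNIV F" "\<And>t. t \<noteq> 0 \<Longrightarrow> (F has_real_derivative 1 / pw \<bar>t\<bar> d1 d1') (at t)"
    using ex_weighted_coordinate[of d1 d1'] assms by auto
  interpret grushin d1 d1' F d2 d2'
    using F assms by unfold_locales auto
  have comp: "AE y in lebesgue. a * \<Gamma> \<phi> y \<le> Gamma C \<phi> y \<and> Gamma C \<phi> y \<le> a' * \<Gamma> \<phi> y" for \<phi> :: "'m pt \<Rightarrow> real"
    using assms(11) by eventually_elim (auto intro: Gamma_bounds)
  have slab_ball: "slab x \<rho> \<subseteq> ballC C x (5 * \<rho> / sqrt a)" if "0 < \<rho>" for x \<rho>
  proof
    fix y assume y: "y \<in> slab x \<rho>"
    have "\<psi> x - \<psi> y \<le> 4 * (1 / sqrt a) * \<rho>" if "\<psi> \<in> C1" "AE z in lebesgue. Gamma C \<psi> z \<le> 1" for \<psi>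
    proof (rule subunit_slab[OF \<open>\<psi> \<in> C1\<close> _ _ \<open>0 < \<rho>\<close> y])
      have "AE z in lebesgue. \<Gamma> \<psi> z \<le> 1 / a"
        using that(2) comp[of \<psi>] by eventually_elim (use assms(7) in \<open>auto simp: field_simps\<close>)
      then have "\<Gamma> \<psi> z \<le> 1 / a" for z
        by (rule AE_le_imp_le[rotated]) (use that(1) assms in \<open>auto intro!: continuous_on_Gamma_Cdelta\<close>)
      then show "\<Gamma> \<psi> z \<le> (1 / sqrt a)\<^sup>2" for z using assms(7) by (simp add: power_divide)
    qed (use assms in auto)
    then have "dist_C C x y \<le> ereal (4 * (1 / sqrt a) * \<rho>)"
      unfolding dist_C_def by (intro SUP_least) auto
    also have "\<dots> < ereal (5 * \<rho> / sqrt a)" using that assms(7) by (simp add: field_simps)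
    finally show "y \<in> ballC C x (5 * \<rho> / sqrt a)" by (simp add: ballC_def)
  qed
  have ball_slab: "ballC C x (\<rho> / (9 * sqrt a')) \<subseteq> slab x \<rho>" if "0 < \<rho>" for x \<rho>
  proof
    fix y assume y: "y \<in> ballC C x (\<rho> / (9 * sqrt a'))"
    show "y \<in> slab x \<rho>"
    proof (rule ccontr)
      assume "y \<notin> slab x \<rho>"
      with \<open>0 < \<rho>\<close> obtain \<psi> where \<psi>: "\<psi> \<in> C1" "\<And>z. \<Gamma> \<psi> z \<le> (1 / sqrt a')\<^sup>2" "\<psi> x - \<psi> y = 1 / sqrt a' * \<rho> / 9"
        using ex_separating[of \<rho> "1 / sqrt a'" y x] assms(8) by auto
      have "AE z in lebesgue. Gamma C \<psi> z \<le> 1"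
        using comp[of \<psi>]
      proof eventually_elim
        case (elim z)
        moreover have "a' * \<Gamma> \<psi> z \<le> a' * (1 / sqrt a')\<^sup>2"
          using assms(8) by (intro mult_left_mono \<psi>(2)) simp
        ultimately have "Gamma C \<psi> z \<le> a' * (1 / sqrt a')\<^sup>2" by linarith
        then show ?case using assms(8) by (simp add: power_divide)
      qed
      then have "ereal (\<psi> x - \<psi> y) \<le> dist_C C x y"
        unfolding dist_C_def using \<psi>(1) by (intro SUP_upper) auto
      also have "\<dots> < ereal (\<rho> / (9 * sqrt a'))" using y by (simp add: ballC_def)
      finally show False using \<psi>(3) by simp
    qed
  qed
  define \<kappa> where "\<kappa> = min 1 (sqrt a / (45 * sqrt a'))"
  have \<kappa>: "0 < \<kappa>" "\<kappa> \<le> 1" using assms by (auto simp: \<kappa>_def)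
  have "\<exists>lam>0. \<forall>x r \<phi>. 0 < r \<longrightarrow> r \<le> R \<longrightarrow> \<phi> \<in> C1 \<longrightarrow>
        ennreal (lam / r\<^sup>2) *
          (\<integral>\<^sup>+ y\<in>ballC C x (\<kappa>*r). ennreal ((\<phi> y - avg \<phi> (ballC C x (\<kappa>*r)))\<^sup>2) \<partial>lebesgue)
        \<le> (\<integral>\<^sup>+ y\<in>ballC C x r. ennreal (Gamma C \<phi> y) \<partial>lebesgue)" if "0 < R" for R
  proof -
    have "0 < 2 * (sqrt a * R / 5)" using that assms(7) by simp
    moreover have "d1 \<le> d1'" using assms(2,3) by linarith
    ultimately obtain K0 where K0: "0 < K0" "\<And>\<alpha> \<beta>. \<alpha> < \<beta> \<Longrightarrow> F \<beta> - F \<alpha> \<le> 2 * (sqrt a * R / 5) \<Longrightarrow>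
      ennreal (\<beta> - \<alpha>) * (\<integral>\<^sup>+ t\<in>{\<alpha>..\<beta>}. ennreal ((1 / pw \<bar>t\<bar> d1 d1')\<^sup>2) \<partial>lborel) \<le> ennreal (K0 * (F \<beta> - F \<alpha>)\<^sup>2)"
      using reverse_Hoelder[OF assms(2)] by blast
    define K where "K = 2 * (4 * K0) + 32 * 2 ^ CARD('m) * (2 powr (d2 + d2'))\<^sup>2"
    have K: "0 < K" using K0(1) by (simp add: K_def add_pos_nonneg)
    have "ennreal (25 / K / r\<^sup>2) *
          (\<integral>\<^sup>+ y\<in>ballC C x (\<kappa>*r). ennreal ((\<phi> y - avg \<phi> (ballC C x (\<kappa>*r)))\<^sup>2) \<partial>lebesgue)
        \<le> (\<integral>\<^sup>+ y\<in>ballC C x r. ennreal (Gamma C \<phi> y) \<partial>lebesgue)"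
      if r: "0 < r" "r \<le> R" and \<phi>: "\<phi> \<in> C1" for x r \<phi>
    proof -
      define \<rho> where "\<rho> = sqrt a * r / 5"
      have \<rho>: "0 < \<rho>" using r assms by (simp add: \<rho>_def)
      have out: "slab x \<rho> \<subseteq> ballC C x r"
        using slab_ball[OF \<rho>, of x] assms(7) by (simp add: \<rho>_def)
      have "ballC C x (\<kappa> * r) \<subseteq> ballC C x (\<rho> / (9 * sqrt a'))"
      proof -
        have "\<kappa> * r \<le> sqrt a / (45 * sqrt a') * r" using r by (intro mult_right_mono) (auto simp: \<kappa>_def)
        then have "ereal (\<kappa> * r) \<le> ereal (\<rho> / (9 * sqrt a'))" by (simp add: \<rho>_def)
        then show ?thesis unfolding ballC_def using order_less_le_trans by blast
      qed
      with ball_slab[OF \<rho>] have inn: "ballC C x (\<kappa> * r) \<subseteq> slab x \<rho>" by blast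
      have diff: "F (hi (x1 x) \<rho>) - F (lo (x1 x) \<rho>) = 2 * \<rho>" by (simp add: F_lo F_hi)
      have "ennreal (hi (x1 x) \<rho> - lo (x1 x) \<rho>) *
        (\<integral>\<^sup>+ t\<in>{lo (x1 x) \<rho>..hi (x1 x) \<rho>}. ennreal ((1 / f1 t)\<^sup>2) \<partial>lborel) \<le> ennreal (K0 * (2 * \<rho>)\<^sup>2)"
        using K0(2)[OF lo_less_hi[OF \<rho>, of "x1 x"]] r assms(7) unfolding diff f1_def by (simp add: \<rho>_def)
      also have "K0 * (2 * \<rho>)\<^sup>2 = 4 * K0 * \<rho>\<^sup>2" by (simp add: power_mult_distrib)
      finally obtain c where c: "(\<integral>\<^sup>+ y\<in>slab x \<rho>. ennreal ((\<phi> y - c)\<^sup>2) \<partial>lborel) \<le>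
        ennreal (K * \<rho>\<^sup>2) * (\<integral>\<^sup>+ y\<in>slab x \<rho>. ennreal (\<Gamma> \<phi> y) \<partial>lborel)"
        using slab_Poincare[OF \<phi> \<rho>, of "4 * K0" x] K0(1) unfolding K_def by auto
      have [measurable]: "slab x \<rho> \<in> sets borel" by (rule slab_borel)
      have [measurable]: "\<Gamma> \<phi> \<in> borel_measurable borel"
        by (rule borel_measurable_continuous_onI, rule continuous_on_Gamma_Cdelta) (use \<phi> assms in auto)
      have "(\<integral>\<^sup>+ y\<in>ballC C x (\<kappa>*r). ennreal ((\<phi> y - avg \<phi> (ballC C x (\<kappa>*r)))\<^sup>2) \<partial>lebesgue)
        \<le> (\<integral>\<^sup>+ y\<in>ballC C x (\<kappa>*r). ennreal ((\<phi> y - c)\<^sup>2) \<partial>lebesgue)"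
        by (rule nn_integral_avg_le) (use C1_continuous_on[OF \<phi>] bounded_subset[OF bounded_slab inn] in auto)
      also have "\<dots> \<le> (\<integral>\<^sup>+ y\<in>slab x \<rho>. ennreal ((\<phi> y - c)\<^sup>2) \<partial>lebesgue)"
        using inn by (intro nn_integral_mono) (auto simp: indicator_def)
      also have "\<dots> \<le> ennreal (K * \<rho>\<^sup>2) * (\<integral>\<^sup>+ y\<in>slab x \<rho>. ennreal (\<Gamma> \<phi> y) \<partial>lborel)"
        using c by (simp add: nn_integral_completion)
      finally have "ennreal (25 / K / r\<^sup>2) *
          (\<integral>\<^sup>+ y\<in>ballC C x (\<kappa>*r). ennreal ((\<phi> y - avg \<phi> (ballC C x (\<kappa>*r)))\<^sup>2) \<partial>lebesgue) \<le>
        ennreal (25 / K / r\<^sup>2) * (ennreal (K * \<rho>\<^sup>2) * (\<integral>\<^sup>+ y\<in>slab x \<rho>. ennreal (\<Gamma> \<phi> y) \<partial>lborel))"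
        by (rule mult_left_mono) simp
      also have "\<dots> = ennreal a * (\<integral>\<^sup>+ y\<in>slab x \<rho>. ennreal (\<Gamma> \<phi> y) \<partial>lborel)"
      proof -
        have "25 / K / r\<^sup>2 * (K * \<rho>\<^sup>2) = a"
          using K r assms(7) by (simp add: \<rho>_def power_divide power_mult_distrib)
        then have "ennreal (25 / K / r\<^sup>2) * ennreal (K * \<rho>\<^sup>2) = ennreal a"
          using K by (simp flip: ennreal_mult)
        then show ?thesis by (simp add: mult.assoc[symmetric])
      qed
      also have "\<dots> = (\<integral>\<^sup>+ y. ennreal a * (ennreal (\<Gamma> \<phi> y) * indicator (slab x \<rho>) y) \<partial>lborel)"
        by (intro nn_integral_cmult[symmetric]) measurable
      also have "\<dots> = (\<integral>\<^sup>+ y. ennreal a * (ennreal (\<Gamma> \<phi> y) * indicator (slab x \<rho>) y) \<partial>lebesgue)"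
        by (simp add: nn_integral_completion)
      also have "\<dots> \<le> (\<integral>\<^sup>+ y\<in>ballC C x r. ennreal (Gamma C \<phi> y) \<partial>lebesgue)"
      proof (rule nn_integral_mono_AE)
        show "AE y in lebesgue. ennreal a * (ennreal (\<Gamma> \<phi> y) * indicator (slab x \<rho>) y)
          \<le> ennreal (Gamma C \<phi> y) * indicator (ballC C x r) y"
          using comp[of \<phi>]
        proof eventually_elim
          case (elim y)
          then show ?case
            using out assms(7) by (auto simp: indicator_def ennreal_mult'[symmetric] intro!: ennreal_leI)
        qed
      qed
      finally show ?thesis .
    qed
    then show ?thesis using K by (intro exI[of _ "25 / K"]) auto
  qed
  then show ?thesis using \<kappa> by blast
qed

end
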